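(* Let $d\ge 1$ and let $\Omega\subset\mathbb{R}^d$ be a domain of finite measure, $|\Omega|<\infty$. Let $Q\in\mathcal{S}'(\mathbb{R}^d)$ be a tempered distribution whose Fourier transform $\widehat{Q}$ is a real-valued function in $L^1_{\rm loc}(\mathbb{R}^d)$ with $\widehat{Q}(\xi)\to 0$ as $|\xi|\to\infty$, and suppose that the convolution operator $$\mathcal{Q}u(x)=\int_\Omega Q(x-y)\,u(y)\,dy$$ is a compact (self-adjoint) operator in $L^2(\Omega)$. Let $\{\lambda_k^{\pm}\}$ be the positive and negative eigenvalues of $\mathcal{Q}$. Then for every $\lambda>0$ $$\sum_k(|\lambda_k^{\pm}|-\lambda)_+\le (2\pi)^{-d}\,|\Omega|\int_{\mathbb{R}^d}(|\widehat{Q}(\xi)|-\lambda)_+\,d\xi .$$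
   Context: $|\Omega|$ is Lebesgue measure and $(t)_+=\max(t,0)$. The Fourier transform is $\widehat{u}(\xi)=\int_{\mathbb{R}^d}e^{-ix\cdot\xi}u(x)\,dx$, extended to tempered distributions. The operator $\mathcal{Q}$ is convolution with $Q$ of functions $u\in L^2(\Omega)$ extended by zero to $\mathbb{R}^d$, restricted to $\Omega$; equivalently $(\mathcal{Q}u,v)_{L^2(\Omega)}=(2\pi)^{-d}\int_{\mathbb{R}^d}\widehat{Q}(\xi)\,\widehat{u}(\xi)\,\overline{\widehat{v}(\xi)}\,d\xi$ for $u,v\in L^2(\Omega)$ (extended by zero). The sum over $k$ runs over all positive eigenvalues $\lambda_k^+$ and all negative eigenvalues $\lambda_k^-$, counted with multiplicity. *)

theory Defs
  imports "HOL-Analysis.Analysis"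
begin

section \<open>Schwartz functions and tempered distributions\<close>

definition partial_deriv :: "'a::euclidean_space \<Rightarrow> ('a \<Rightarrow> complex) \<Rightarrow> 'a \<Rightarrow> complex" where
  "partial_deriv b f = (\<lambda>x. frechet_derivative f (at x) b)"

text \<open>A multi-index is represented by a list of basis vectors; its length is the order of the
  derivative.\<close>

definition iterated_partial :: "'a::euclidean_space list \<Rightarrow> ('a \<Rightarrow> complex) \<Rightarrow> 'a \<Rightarrow> complex" where
  "iterated_partial bs f = foldr partial_deriv bs f"

definition smooth :: "('a::euclidean_space \<Rightarrow> complex) \<Rightarrow> bool" where
  "smooth f \<longleftrightarrow> (\<forall>bs x. set bs \<subseteq> Basis \<longrightarrow> iterated_partial bs f differentiable (at x))"

definition schwartz :: "('a::euclidean_space \<Rightarrow> complex) set" where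
  "schwartz = {f. smooth f \<and>
     (\<forall>k bs. set bs \<subseteq> Basis \<longrightarrow>
        (\<exists>C. \<forall>x. norm x ^ k * norm (iterated_partial bs f x) \<le> C))}"

definition schwartz_seminorm :: "nat \<Rightarrow> ('a::euclidean_space \<Rightarrow> complex) \<Rightarrow> real" where
  "schwartz_seminorm N f =
     (SUP (k, bs, x) \<in> {..N} \<times> {bs. set bs \<subseteq> Basis \<and> length bs \<le> N} \<times> UNIV.
        norm x ^ k * norm (iterated_partial bs f x))"

text \<open>A distribution is a functional on all functions, of which only the values on Schwartz
  functions are relevant. The pairing is bilinear (no complex conjugation).\<close>

definition tempered_distribution :: "(('a::euclidean_space \<Rightarrow> complex) \<Rightarrow> complex) \<Rightarrow> bool" where
  "tempered_distribution T \<longleftrightarrow>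
     (\<forall>f\<in>schwartz. \<forall>g\<in>schwartz. T (\<lambda>x. f x + g x) = T f + T g) \<and>
     (\<forall>c. \<forall>f\<in>schwartz. T (\<lambda>x. c * f x) = c * T f) \<and>
     (\<exists>C N. \<forall>f\<in>schwartz. norm (T f) \<le> C * schwartz_seminorm N f)"

definition fourier :: "('a::euclidean_space \<Rightarrow> complex) \<Rightarrow> 'a \<Rightarrow> complex" where
  "fourier f \<xi> = (\<integral>x. exp (- (\<i> * of_real (x \<bullet> \<xi>))) * f x \<partial>lebesgue)"

definition fourier_distr ::
    "(('a::euclidean_space \<Rightarrow> complex) \<Rightarrow> complex) \<Rightarrow> ('a \<Rightarrow> complex) \<Rightarrow> complex" where
  "fourier_distr T f = T (fourier f)"

definition represented_by ::
    "(('a::euclidean_space \<Rightarrow> complex) \<Rightarrow> complex) \<Rightarrow> ('a \<Rightarrow> complex) \<Rightarrow> bool" where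
  "represented_by T q \<longleftrightarrow>
     (\<forall>f\<in>schwartz. integrable lebesgue (\<lambda>\<xi>. q \<xi> * f \<xi>) \<and>
        T f = (\<integral>\<xi>. q \<xi> * f \<xi> \<partial>lebesgue))"

definition locally_integrable :: "('a::euclidean_space \<Rightarrow> real) \<Rightarrow> bool" where
  "locally_integrable q \<longleftrightarrow> (\<forall>K. compact K \<longrightarrow> q absolutely_integrable_on K)"

section \<open>The space $L^2(\Omega)$\<close>

text \<open>Elements of $L^2(\Omega)$ are handled through representatives; values outside
  \<open>\<Omega>\<close> are irrelevant, and equality is equality almost everywhere on \<open>\<Omega>\<close>.\<close>

definition L2 :: "'a::euclidean_space set \<Rightarrow> ('a \<Rightarrow> complex) set" where
  "L2 \<Omega> = {u \<in> borel_measurable (lebesgue_on \<Omega>). integrable (lebesgue_on \<Omega>) (\<lambda>x. (norm (u x))\<^sup>2)}"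

definition l2_inner ::
    "'a::euclidean_space set \<Rightarrow> ('a \<Rightarrow> complex) \<Rightarrow> ('a \<Rightarrow> complex) \<Rightarrow> complex" where
  "l2_inner \<Omega> u v = (\<integral>x. u x * cnj (v x) \<partial>lebesgue_on \<Omega>)"

definition l2_norm :: "'a::euclidean_space set \<Rightarrow> ('a \<Rightarrow> complex) \<Rightarrow> real" where
  "l2_norm \<Omega> u = sqrt (\<integral>x. (norm (u x))\<^sup>2 \<partial>lebesgue_on \<Omega>)"

definition zero_ext :: "'a set \<Rightarrow> ('a \<Rightarrow> complex) \<Rightarrow> 'a \<Rightarrow> complex" where
  "zero_ext \<Omega> u = (\<lambda>x. if x \<in> \<Omega> then u x else 0)"

definition l2_compact ::
    "'a::euclidean_space set \<Rightarrow> (('a \<Rightarrow> complex) \<Rightarrow> 'a \<Rightarrow> complex) \<Rightarrow> bool" where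
  "l2_compact \<Omega> A \<longleftrightarrow>
     (\<forall>u :: nat \<Rightarrow> 'a \<Rightarrow> complex. (\<forall>n. u n \<in> L2 \<Omega>) \<and> (\<exists>B. \<forall>n. l2_norm \<Omega> (u n) \<le> B) \<longrightarrow>
        (\<exists>r w. strict_mono r \<and> w \<in> L2 \<Omega> \<and>
           (\<lambda>n. l2_norm \<Omega> (\<lambda>x. A (u (r n)) x - w x)) \<longlonglongrightarrow> 0))"

definition l2_selfadjoint ::
    "'a::euclidean_space set \<Rightarrow> (('a \<Rightarrow> complex) \<Rightarrow> 'a \<Rightarrow> complex) \<Rightarrow> bool" where
  "l2_selfadjoint \<Omega> A \<longleftrightarrow> (\<forall>u\<in>L2 \<Omega>. \<forall>v\<in>L2 \<Omega>. l2_inner \<Omega> (A u) v = l2_inner \<Omega> u (A v))"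

text \<open>Convolution with \<open>Q\<close> of functions extended by zero, followed by restriction to \<open>\<Omega>\<close>, for
  distributions \<open>Q\<close> whose Fourier transform is a function \<open>q\<close>. Since \<open>Q\<close> need not be a function,
  the operator is given by its sesquilinear form. The representative \<open>q\<close> is unique up to null sets,
  so quantifying over all representatives imposes one condition only; this is meaningful only if a
  representative exists. The form determines \<open>A u\<close> up to equality almost everywhere on \<open>\<Omega>\<close>, so
  linearity of \<open>A\<close> (almost everywhere) is a consequence.\<close>

definition convolution_operator ::
    "'a::euclidean_space set \<Rightarrow> (('a \<Rightarrow> complex) \<Rightarrow> complex) \<Rightarrow>
       (('a \<Rightarrow> complex) \<Rightarrow> 'a \<Rightarrow> complex) \<Rightarrow> bool" where
  "convolution_operator \<Omega> Q A \<longleftrightarrow>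
     (\<forall>u\<in>L2 \<Omega>. A u \<in> L2 \<Omega>) \<and>
     (\<forall>q. represented_by (fourier_distr Q) q \<longrightarrow>
        (\<forall>u\<in>L2 \<Omega>. \<forall>v\<in>L2 \<Omega>.
           l2_inner \<Omega> (A u) v =
             (\<integral>\<xi>. q \<xi> * fourier (zero_ext \<Omega> u) \<xi> * cnj (fourier (zero_ext \<Omega> v) \<xi>) \<partial>lebesgue)
               / (2 * pi) ^ DIM('a)))"

section \<open>Eigenvalues with multiplicity\<close>

definition eigenspace ::
    "'a::euclidean_space set \<Rightarrow> (('a \<Rightarrow> complex) \<Rightarrow> 'a \<Rightarrow> complex) \<Rightarrow> real \<Rightarrow> ('a \<Rightarrow> complex) set" where
  "eigenspace \<Omega> A \<mu> = {u \<in> L2 \<Omega>. AE x in lebesgue_on \<Omega>. A u x = of_real \<mu> * u x}"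

definition l2_independent :: "'a::euclidean_space set \<Rightarrow> nat \<Rightarrow> (nat \<Rightarrow> 'a \<Rightarrow> complex) \<Rightarrow> bool" where
  "l2_independent \<Omega> n f \<longleftrightarrow>
     (\<forall>c. (AE x in lebesgue_on \<Omega>. (\<Sum>i<n. c i * f i x) = 0) \<longrightarrow> (\<forall>i<n. c i = 0))"

text \<open>The dimension of the eigenspace as a subspace of $L^2(\Omega)$; it is \<open>0\<close> if \<open>\<mu>\<close> is not an
  eigenvalue.\<close>

definition multiplicity ::
    "'a::euclidean_space set \<Rightarrow> (('a \<Rightarrow> complex) \<Rightarrow> 'a \<Rightarrow> complex) \<Rightarrow> real \<Rightarrow> enat" where
  "multiplicity \<Omega> A \<mu> =
     (SUP n \<in> {n. \<exists>f. (\<forall>i<n. f i \<in> eigenspace \<Omega> A \<mu>) \<and> l2_independent \<Omega> n f}. enat n)"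

text \<open>\<open>(ev k)\<close> for \<open>k \<in> K\<close> lists the eigenvalues of \<open>A\<close> lying in \<open>S\<close>, each repeated according to
  its multiplicity. The index set \<open>K\<close> may be finite or infinite.\<close>

definition enumerates_eigenvalues ::
    "'a::euclidean_space set \<Rightarrow> (('a \<Rightarrow> complex) \<Rightarrow> 'a \<Rightarrow> complex) \<Rightarrow> real set \<Rightarrow>
       nat set \<Rightarrow> (nat \<Rightarrow> real) \<Rightarrow> bool" where
  "enumerates_eigenvalues \<Omega> A S K ev \<longleftrightarrow>
     (\<forall>k\<in>K. ev k \<in> S) \<and>
     (\<forall>\<mu>\<in>S. finite {k\<in>K. ev k = \<mu>} \<and> enat (card {k\<in>K. ev k = \<mu>}) = multiplicity \<Omega> A \<mu>)"

end

theory Submission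
  imports Defs "HOL-Probability.Characteristic_Functions"
begin

text \<open>
  Write \<open>d\<close> for the dimension, \<open>q\<close> for the Fourier transform of the convolution kernel and \<open>u^\<close> for
  that of \<open>u\<close> extended by zero. Take an orthonormal family of eigenfunctions \<open>u\<^sub>k\<close>, one for each
  enumerated eigenvalue. The quadratic form of the operator gives
  \<open>\<mu>\<^sub>k = (2\<pi>)^(-d) \<integral> q |u\<^sub>k^|\<^sup>2\<close>, while \<open>1 = \<parallel>u\<^sub>k\<parallel>\<^sup>2 \<ge> (2\<pi>)^(-d) \<integral> |u\<^sub>k^|\<^sup>2\<close>. Subtracting \<open>\<lambda>\<close> times
  the second relation from the first, for positive \<open>\<mu>\<^sub>k\<close>,
  \<open>\<mu>\<^sub>k - \<lambda> \<le> (2\<pi>)^(-d) \<integral> (q - \<lambda>)\<^sub>+ |u\<^sub>k^|\<^sup>2\<close>,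
  and the same with \<open>-q\<close> in place of \<open>q\<close> bounds \<open>-\<mu>\<^sub>k - \<lambda>\<close> for negative \<open>\<mu>\<^sub>k\<close>.
  The value \<open>u\<^sub>k^(\<xi>)\<close> is the inner product of \<open>u\<^sub>k\<close> with the plane wave of frequency \<open>\<xi>\<close> on
  \<open>\<Omega>\<close>, whose squared norm is \<open>|\<Omega>|\<close>; so Bessel's inequality gives
  \<open>\<Sum>\<^sub>k |u\<^sub>k^(\<xi>)|\<^sup>2 \<le> |\<Omega>|\<close> pointwise in \<open>\<xi>\<close>. Summing over \<open>k\<close> yields one bound for each sign, and
  \<open>(q - \<lambda>)\<^sub>+ + (-q - \<lambda>)\<^sub>+ = (|q| - \<lambda>)\<^sub>+\<close> because \<open>\<lambda> > 0\<close>.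

  Three ingredients carry this. The inequality half of Plancherel's theorem
  (\<open>nn_integral_fourier_power2_le\<close>) comes from damping \<open>|u^|\<^sup>2\<close> by a Gaussian: this turns the integral
  into a double integral of \<open>u(x) u(y)\<close>, the second factor conjugated, against a Gaussian kernel of
  total mass \<open>(2\<pi>)^d\<close>, which the Schur test bounds independently of the damping. The orthonormal
  eigenfunctions (\<open>orthonormal_eigenfunctions\<close>) come from Gram-Schmidt inside each eigenspace and
  from self-adjointness between different ones. Bessel's inequality (\<open>l2_bessel\<close>) then gives the
  pointwise bound \<open>sum_fourier_orthonormal_le\<close>.
\<close>

section \<open>Measurability and products for Lebesgue measure\<close>

lemma sigma_finite_lebesgue: "sigma_finite_measure (lebesgue :: 'a::euclidean_space measure)"
proof (rule sigma_finite_measure.intro)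
  obtain A :: "'a set set" where A: "countable A" "A \<subseteq> sets lborel" "\<Union>A = space lborel"
      "\<forall>a\<in>A. emeasure lborel a \<noteq> \<infinity>"
    using lborel.sigma_finite_countable by blast
  then show "\<exists>A::'a set set. countable A \<and> A \<subseteq> sets lebesgue \<and> \<Union>A = space lebesgue \<and>
      (\<forall>a\<in>A. emeasure lebesgue a \<noteq> \<infinity>)"
    by (intro exI[of _ A]) (auto simp: subset_iff)
qed

lemma pair_sigma_finite_lebesgue:
  "pair_sigma_finite (lebesgue :: 'a::euclidean_space measure) (lebesgue :: 'b::euclidean_space measure)"
  by (intro pair_sigma_finite.intro sigma_finite_lebesgue)

lemma cnj_measurable [measurable]: "cnj \<in> borel_measurable borel"
  by (intro borel_measurable_continuous_onI continuous_intros)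

text \<open>
  The function is the pointwise limit of its restrictions to balls of integer radius.
\<close>

lemma measurable_if_locally_integrable:
  fixes q :: "'a::euclidean_space \<Rightarrow> real"
  assumes "locally_integrable q"
  shows "q \<in> borel_measurable lebesgue"
proof (rule borel_measurable_LIMSEQ_real)
  fix n :: nat
  have "q absolutely_integrable_on cball 0 (real n)"
    using assms by (simp add: locally_integrable_def)
  then show "(\<lambda>x. indicator (cball 0 (real n)) x *\<^sub>R q x) \<in> borel_measurable lebesgue"
    unfolding set_integrable_def by (rule borel_measurable_integrable)
next
  fix x :: 'a
  obtain N :: nat where N: "norm x \<le> real N" using real_arch_simple by blast
  have "indicator (cball 0 (real n)) x *\<^sub>R q x = q x" if "n \<ge> N" for n
    using N that by (simp add: indicator_def order_trans[of _ "real N"])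
  then show "(\<lambda>n. indicator (cball 0 (real n)) x *\<^sub>R q x) \<longlonglongrightarrow> q x"
    by (intro tendsto_eventually) (auto simp: eventually_sequentially)
qed

section \<open>Fourier transform of Gaussians\<close>

text \<open>
  Fubini's theorem in coordinates: this reduces Gaussian integrals on a Euclidean space to
  one-dimensional ones.
\<close>

lemma integral_lborel_prod:
  fixes f :: "'a::euclidean_space \<Rightarrow> real \<Rightarrow> complex"
  assumes f: "\<And>b. b \<in> Basis \<Longrightarrow> integrable lborel (f b)"
  shows "integrable lborel (\<lambda>x::'a. \<Prod>b\<in>Basis. f b (x \<bullet> b))"
    and "(\<integral>x. (\<Prod>b\<in>Basis. f b (x \<bullet> b)) \<partial>(lborel :: 'a measure)) = (\<Prod>b\<in>Basis. \<integral>t. f b t \<partial>lborel)"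
proof -
  interpret product_sigma_finite "\<lambda>b::'a. lborel :: real measure" ..
  let ?P = "\<Pi>\<^sub>M b\<in>(Basis::'a set). (lborel :: real measure)"
  let ?T = "\<lambda>g::'a \<Rightarrow> real. \<Sum>b\<in>Basis. g b *\<^sub>R b"
  have T[measurable]: "?T \<in> measurable ?P borel" by measurable
  have [measurable]: "b \<in> Basis \<Longrightarrow> f b \<in> borel_measurable borel" for b
    using f[of b] by (auto dest: borel_measurable_integrable)
  have m: "(\<lambda>x::'a. \<Prod>b\<in>Basis. f b (x \<bullet> b)) \<in> borel_measurable borel" by measurable
  have coord: "(\<Prod>b\<in>Basis. f b (?T g \<bullet> b)) = (\<Prod>b\<in>Basis. f b (g b))" for g by simp
  have "integrable ?P (\<lambda>g. \<Prod>b\<in>Basis. f b (?T g \<bullet> b))"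
    unfolding coord by (rule product_integrable_prod) (auto intro: f)
  then show "integrable lborel (\<lambda>x::'a. \<Prod>b\<in>Basis. f b (x \<bullet> b))"
    by (subst lborel_eq) (simp only: integrable_distr_eq[OF T m])
  have "(\<integral>x. (\<Prod>b\<in>Basis. f b (x \<bullet> b)) \<partial>(lborel :: 'a measure)) = (\<integral>g. (\<Prod>b\<in>Basis. f b (?T g \<bullet> b)) \<partial>?P)"
    by (subst lborel_eq) (rule integral_distr[OF T m])
  also have "\<dots> = (\<Prod>b\<in>Basis. \<integral>t. f b t \<partial>lborel)"
    unfolding coord by (rule product_integral_prod) (auto intro: f)
  finally show "(\<integral>x. (\<Prod>b\<in>Basis. f b (x \<bullet> b)) \<partial>(lborel :: 'a measure)) = (\<Prod>b\<in>Basis. \<integral>t. f b t \<partial>lborel)" .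
qed

text \<open>
  After the substitution \<open>t \<mapsto> s t\<close> the integral is the characteristic function of the standard
  normal distribution at \<open>-z / s\<close>. Writing the result as a normal density lets its total mass be
  read off later without another Gaussian integral.
\<close>

lemma fourier_gaussian_1d:
  fixes s z :: real
  assumes s: "0 < s"
  defines "g \<equiv> \<lambda>t::real. exp (- (\<i> * of_real (t * z))) * complex_of_real (exp (- (s\<^sup>2 * t\<^sup>2) / 2))"
  shows "integrable lborel g"
    and "(\<integral>t. g t \<partial>lborel) = of_real (2 * pi * normal_density 0 s z)"
proof -
  define h where "h = (\<lambda>t::real. std_normal_density t *\<^sub>R iexp (- (z / s) * t))"
  have h_g: "g t = of_real (sqrt (2 * pi)) * h (0 + s * t)" for t
    using s by (simp add: g_def h_def std_normal_density_def scaleR_conv_of_real power_mult_distrib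
        field_simps)
  have h1: "integrable lborel h"
  proof (rule Bochner_Integration.integrable_bound)
    show "integrable lborel std_normal_density" by simp
    show "h \<in> borel_measurable lborel" unfolding h_def by measurable
    show "AE t in lborel. norm (h t) \<le> norm (std_normal_density t)"
      by (auto simp: h_def)
  qed
  have h2: "integral\<^sup>L lborel h = complex_of_real (exp (- ((z / s)\<^sup>2) / 2))"
  proof -
    have "char std_normal_distribution (- (z / s)) = integral\<^sup>L lborel h"
      unfolding char_def h_def by (subst integral_density) (auto simp: normal_density_nonneg)
    then show ?thesis by (simp add: char_std_normal_distribution)
  qed
  show "integrable lborel g"
    unfolding h_g using lborel_integrable_real_affine[OF h1, of s 0] s by simp
  have "integral\<^sup>L lborel h = \<bar>s\<bar> *\<^sub>R (\<integral>t. h (0 + s * t) \<partial>lborel)"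
    using s by (intro lborel_integral_real_affine) simp
  then have "(\<integral>t. h (0 + s * t) \<partial>lborel) = of_real (exp (- ((z / s)\<^sup>2) / 2) / s)"
    using s h2 by (simp add: scaleR_conv_of_real field_simps)
  then have "(\<integral>t. g t \<partial>lborel) = of_real (sqrt (2 * pi) * (exp (- ((z / s)\<^sup>2) / 2) / s))"
    unfolding h_g by simp
  also have "sqrt (2 * pi) * (exp (- ((z / s)\<^sup>2) / 2) / s) = 2 * pi * normal_density 0 s z"
  proof -
    have "sqrt (2 * pi) * sqrt (2 * pi) = 2 * pi" by simp
    then show ?thesis
      using s by (simp add: normal_density_def real_sqrt_mult power_divide field_simps)
  qed
  finally show "(\<integral>t. g t \<partial>lborel) = of_real (2 * pi * normal_density 0 s z)" .
qed

definition gaussian :: "real \<Rightarrow> 'a::euclidean_space \<Rightarrow> real" where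
  "gaussian s \<xi> = exp (- (s\<^sup>2 * (norm \<xi>)\<^sup>2) / 2)"

text \<open>
  The Fourier transform of \<open>gaussian s\<close>: \<open>(2\<pi>)^d\<close> times the density of \<open>d\<close> independent centred
  normal variables with standard deviation \<open>s\<close>, an approximate identity as \<open>s \<rightarrow> 0\<close>.
\<close>

definition gaussian_kernel :: "real \<Rightarrow> 'a::euclidean_space \<Rightarrow> real" where
  "gaussian_kernel s z = (\<Prod>b\<in>Basis. 2 * pi * normal_density 0 s (z \<bullet> b))"

lemma gaussian_eq_prod: "gaussian s \<xi> = (\<Prod>b\<in>Basis. exp (- (s\<^sup>2 * (\<xi> \<bullet> b)\<^sup>2) / 2))"
proof -
  have "(norm \<xi>)\<^sup>2 = (\<Sum>b\<in>Basis. (\<xi> \<bullet> b)\<^sup>2)"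
    unfolding power2_norm_eq_inner by (subst euclidean_inner) (simp add: power2_eq_square)
  then have "- (s\<^sup>2 * (norm \<xi>)\<^sup>2) / 2 = (\<Sum>b\<in>Basis. - (s\<^sup>2 * (\<xi> \<bullet> b)\<^sup>2) / 2)"
    by (simp add: sum_distrib_left sum_divide_distrib sum_negf)
  then show ?thesis by (simp add: gaussian_def exp_sum)
qed

lemma gaussian_measurable [measurable]: "gaussian s \<in> borel_measurable borel"
  unfolding gaussian_def[abs_def] by measurable

lemma gaussian_kernel_measurable [measurable]: "gaussian_kernel s \<in> borel_measurable borel"
  unfolding gaussian_kernel_def[abs_def] by measurable

lemma gaussian_kernel_translate_measurable [measurable]:
  "(\<lambda>y. gaussian_kernel s (x - y)) \<in> borel_measurable lebesgue"
  "(\<lambda>y. gaussian_kernel s (y - x)) \<in> borel_measurable lebesgue"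
  by (rule measurable_completion, measurable)+

lemma gaussian_kernel_nonneg: "0 \<le> gaussian_kernel s z"
  unfolding gaussian_kernel_def by (intro prod_nonneg) auto

lemma fourier_gaussian:
  fixes z :: "'a::euclidean_space"
  assumes s: "0 < s"
  shows "integrable lebesgue (\<lambda>\<xi>::'a. gaussian s \<xi>)"
    and "fourier (\<lambda>\<xi>. of_real (gaussian s \<xi>)) z = of_real (gaussian_kernel s z)"
proof -
  define g where "g = (\<lambda>z t::real. exp (- (\<i> * of_real (t * z))) * complex_of_real (exp (- (s\<^sup>2 * t\<^sup>2) / 2)))"
  have g: "exp (- (\<i> * of_real (\<xi> \<bullet> z))) * complex_of_real (gaussian s \<xi>)
      = (\<Prod>b\<in>Basis. g (z \<bullet> b) (\<xi> \<bullet> b))" for \<xi> z :: 'a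
  proof -
    have "- (\<i> * of_real (\<xi> \<bullet> z)) = (\<Sum>b\<in>Basis. - (\<i> * of_real ((\<xi> \<bullet> b) * (z \<bullet> b))))"
      by (subst euclidean_inner) (simp add: sum_distrib_left sum_negf)
    then show ?thesis
      by (simp only: exp_sum[OF finite_Basis] gaussian_eq_prod of_real_prod prod.distrib g_def)
  qed
  have gi: "integrable lborel (g t)" for t
    unfolding g_def by (rule fourier_gaussian_1d(1)[OF s])
  have "integrable lborel (\<lambda>\<xi>::'a. complex_of_real (gaussian s \<xi>))"
    using integral_lborel_prod(1)[of "\<lambda>_::'a. g 0", OF gi] g[of _ 0] by simp
  then have "integrable lborel (\<lambda>\<xi>::'a. gaussian s \<xi>)"
    by (simp only: complex_of_real_integrable_eq)
  then show "integrable lebesgue (\<lambda>\<xi>::'a. gaussian s \<xi>)"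
    by (subst integrable_completion) auto
  have "fourier (\<lambda>\<xi>. of_real (gaussian s \<xi>)) z =
      (\<integral>\<xi>. exp (- (\<i> * of_real (\<xi> \<bullet> z))) * complex_of_real (gaussian s \<xi>) \<partial>lborel)"
    unfolding fourier_def by (subst integral_completion) auto
  also have "\<dots> = (\<Prod>b\<in>Basis. \<integral>t. g (z \<bullet> b) t \<partial>lborel)"
    unfolding g by (rule integral_lborel_prod(2)[OF gi])
  also have "\<dots> = of_real (gaussian_kernel s z)"
    unfolding gaussian_kernel_def g_def using fourier_gaussian_1d(2)[OF s] by simp
  finally show "fourier (\<lambda>\<xi>. of_real (gaussian s \<xi>)) z = of_real (gaussian_kernel s z)" .
qed

lemma nn_integral_gaussian_kernel:
  fixes x :: "'a::euclidean_space"
  assumes s: "0 < s"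
  shows "(\<integral>\<^sup>+y. ennreal (gaussian_kernel s (x - y)) \<partial>lebesgue) = ennreal ((2 * pi) ^ DIM('a))"
proof -
  have two_pi: "0 \<le> 2 * pi" by simp
  have nd: "normal_density 0 s ((x - y) \<bullet> b) = normal_density (x \<bullet> b) s (y \<bullet> b)" for y b :: 'a
    by (simp add: normal_density_def inner_diff_left power2_commute)
  have "(\<integral>\<^sup>+y. ennreal (gaussian_kernel s (x - y)) \<partial>lebesgue) =
      (\<integral>\<^sup>+y. (\<Prod>b\<in>Basis. ennreal (2 * pi * normal_density (x \<bullet> b) s (y \<bullet> b))) \<partial>lborel)"
    by (simp add: nn_integral_completion gaussian_kernel_def nd prod_ennreal)
  also have "\<dots> = (\<Prod>b\<in>Basis. (\<integral>\<^sup>+t. ennreal (2 * pi * normal_density (x \<bullet> b) s t) \<partial>lborel))"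
    by (subst nn_integral_lborel_prod[symmetric]) auto
  also have "\<dots> = (\<Prod>b\<in>(Basis::'a set). ennreal (2 * pi))"
    using s by (intro prod.cong refl, subst nn_integral_eq_integral) auto
  also have "\<dots> = ennreal ((2 * pi) ^ DIM('a))"
    by (simp only: prod_constant ennreal_power[OF two_pi])
  finally show ?thesis .
qed

section \<open>The inequality half of Plancherel's theorem\<close>

lemma borel_measurable_id_lebesgue [measurable]: "(\<lambda>x. x) \<in> borel_measurable lebesgue"
  by (rule measurable_completion) simp

lemma integrable_product_lebesgue:
  fixes u :: "'a::euclidean_space \<Rightarrow> complex" and h :: "'b::euclidean_space \<Rightarrow> complex"
  assumes u: "integrable lebesgue u" and h: "integrable lebesgue h"
  shows "integrable (lebesgue \<Otimes>\<^sub>M lebesgue) (\<lambda>(x, y). u x * h y)"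
proof -
  interpret pair_sigma_finite "lebesgue :: 'a measure" "lebesgue :: 'b measure"
    by (rule pair_sigma_finite_lebesgue)
  have [measurable]: "u \<in> borel_measurable lebesgue" "h \<in> borel_measurable lebesgue"
    using u h by (auto dest: borel_measurable_integrable)
  show ?thesis
    by (rule Fubini_integrable) (use u h in \<open>auto simp: norm_mult\<close>)
qed

lemma projections_measurable_lebesgue:
  "(\<lambda>p::'a::euclidean_space \<times> 'b::euclidean_space. fst p) \<in> borel_measurable (lebesgue \<Otimes>\<^sub>M lebesgue)"
  "(\<lambda>p::'a::euclidean_space \<times> 'b::euclidean_space. snd p) \<in> borel_measurable (lebesgue \<Otimes>\<^sub>M lebesgue)"
  by (rule measurable_compose[OF measurable_fst borel_measurable_id_lebesgue]
      measurable_compose[OF measurable_snd borel_measurable_id_lebesgue])+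

lemma measurable_pairing [measurable]:
  "(\<lambda>p::'a::euclidean_space \<times> 'a. fst p \<bullet> snd p) \<in> borel_measurable (lebesgue \<Otimes>\<^sub>M lebesgue)"
proof -
  note projections_measurable_lebesgue [measurable]
  show ?thesis by measurable
qed

lemma norm_integral_le_nn_integral:
  fixes f :: "'a \<Rightarrow> 'b::{banach, second_countable_topology}"
  shows "ennreal (norm (integral\<^sup>L M f)) \<le> (\<integral>\<^sup>+x. ennreal (norm (f x)) \<partial>M)"
  by (cases "integrable M f") (auto simp: integral_norm_bound_ennreal not_integrable_integral_eq)

lemma norm_exp_imaginary: "norm (exp (- (\<i> * complex_of_real t))) = 1"
  by (simp add: norm_exp_eq_Re)

lemma fourier_measurable [measurable]:
  fixes u :: "'a::euclidean_space \<Rightarrow> complex"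
  assumes [measurable]: "u \<in> borel_measurable lebesgue"
  shows "fourier u \<in> borel_measurable lebesgue"
proof -
  interpret sigma_finite_measure "lebesgue :: 'a measure" by (rule sigma_finite_lebesgue)
  have "(\<lambda>\<xi>. \<integral>x. exp (- (\<i> * complex_of_real (\<xi> \<bullet> x))) * u x \<partial>lebesgue) \<in> borel_measurable lebesgue"
    by (rule borel_measurable_lebesgue_integral) (unfold case_prod_beta, measurable)
  then show ?thesis by (simp add: fourier_def[abs_def] inner_commute)
qed

lemma norm_fourier_le: "norm (fourier u \<xi>) \<le> (\<integral>x. norm (u x) \<partial>lebesgue)"
proof -
  have "norm (fourier u \<xi>) \<le> (\<integral>x. norm (exp (- (\<i> * complex_of_real (x \<bullet> \<xi>))) * u x) \<partial>lebesgue)"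
    unfolding fourier_def by (rule integral_norm_bound)
  then show ?thesis by (simp add: norm_mult norm_exp_imaginary)
qed

text \<open>
  Both sides are iterated integrals of \<open>e^(-i x \<cdot> \<xi>) u(x) h(\<xi>)\<close>, which is integrable on the product
  space because its modulus is \<open>|u(x)| |h(\<xi>)|\<close>.
\<close>

lemma fourier_multiplication_formula:
  fixes u h :: "'a::euclidean_space \<Rightarrow> complex"
  assumes u: "integrable lebesgue u" and h: "integrable lebesgue h"
  shows "(\<integral>\<xi>. fourier u \<xi> * h \<xi> \<partial>lebesgue) = (\<integral>x. u x * fourier h x \<partial>lebesgue)"
proof -
  interpret pair_sigma_finite "lebesgue :: 'a measure" "lebesgue :: 'a measure"
    by (rule pair_sigma_finite_lebesgue)
  have [measurable]: "u \<in> borel_measurable lebesgue" "h \<in> borel_measurable lebesgue"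
    using u h by (auto dest: borel_measurable_integrable)
  let ?f = "\<lambda>x \<xi>. exp (- (\<i> * complex_of_real (x \<bullet> \<xi>))) * (u x * h \<xi>)"
  have int: "integrable (lebesgue \<Otimes>\<^sub>M lebesgue) (case_prod ?f)"
  proof (rule Bochner_Integration.integrable_bound[OF integrable_product_lebesgue[OF u h]])
    show "case_prod ?f \<in> borel_measurable (lebesgue \<Otimes>\<^sub>M lebesgue)"
      unfolding case_prod_beta by measurable
  qed (auto simp: norm_mult norm_exp_imaginary)
  have "(\<integral>\<xi>. fourier u \<xi> * h \<xi> \<partial>lebesgue) = (\<integral>\<xi>. (\<integral>x. ?f x \<xi> \<partial>lebesgue) \<partial>lebesgue)"
    by (simp add: fourier_def mult.assoc[symmetric])
  also have "\<dots> = (\<integral>x. (\<integral>\<xi>. ?f x \<xi> \<partial>lebesgue) \<partial>lebesgue)"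
    by (rule Fubini_integral[OF int])
  also have "\<dots> = (\<integral>x. u x * fourier h x \<partial>lebesgue)"
    by (simp add: fourier_def inner_commute mult_ac flip: integral_mult_right_zero)
  finally show ?thesis .
qed

lemma gaussian_kernel_commute: "gaussian_kernel s (x - y) = gaussian_kernel s (y - x)"
  by (simp add: gaussian_kernel_def normal_density_def inner_diff_left power2_commute)

text \<open>
  The Schur test for a symmetric kernel: \<open>|u(x) u(y)| \<le> (|u(x)|\<^sup>2 + |u(y)|\<^sup>2) / 2\<close>, and integrating
  the kernel over the free variable gives \<open>(2\<pi>)^d\<close> in both terms. The point is that the bound does
  not depend on \<open>s\<close>.
\<close>

lemma gaussian_kernel_schur:
  fixes u :: "'a::euclidean_space \<Rightarrow> complex"
  assumes s: "0 < s" and [measurable]: "u \<in> borel_measurable lebesgue"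
  shows "(\<integral>\<^sup>+x. \<integral>\<^sup>+y. ennreal (norm (u x) * norm (u y) * gaussian_kernel s (x - y)) \<partial>lebesgue \<partial>lebesgue)
    \<le> ennreal ((2 * pi) ^ DIM('a)) * (\<integral>\<^sup>+x. ennreal ((norm (u x))\<^sup>2) \<partial>lebesgue)"
proof -
  interpret pair_sigma_finite "lebesgue :: 'a measure" "lebesgue :: 'a measure"
    by (rule pair_sigma_finite_lebesgue)
  note projections_measurable_lebesgue [measurable]
  let ?h = "\<lambda>x. ennreal ((norm (u x))\<^sup>2 / 2)"
  let ?G = "\<lambda>x y. ennreal (gaussian_kernel s (x - y))"
  let ?C = "ennreal ((2 * pi) ^ DIM('a))"
  have mG[measurable]: "(\<lambda>p. ?G (fst p) (snd p)) \<in> borel_measurable (lebesgue \<Otimes>\<^sub>M lebesgue)"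
    by measurable
  have amgm: "ennreal (norm (u x) * norm (u y) * gaussian_kernel s (x - y))
      \<le> ?h x * ?G x y + ?h y * ?G x y" for x y
  proof -
    have "norm (u x) * norm (u y) \<le> (norm (u x))\<^sup>2 / 2 + (norm (u y))\<^sup>2 / 2"
      using sum_squares_bound[of "norm (u x)" "norm (u y)"] by simp
    then have "norm (u x) * norm (u y) * gaussian_kernel s (x - y)
        \<le> (norm (u x))\<^sup>2 / 2 * gaussian_kernel s (x - y) + (norm (u y))\<^sup>2 / 2 * gaussian_kernel s (x - y)"
      by (metis distrib_right gaussian_kernel_nonneg mult_right_mono)
    then show ?thesis
      by (simp add: gaussian_kernel_nonneg flip: ennreal_mult ennreal_plus)
  qed
  have row: "(\<integral>\<^sup>+x. \<integral>\<^sup>+y. ?h x * ?G x y \<partial>lebesgue \<partial>lebesgue) = ?C * (\<integral>\<^sup>+x. ?h x \<partial>lebesgue)"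
    by (simp add: nn_integral_cmult nn_integral_gaussian_kernel[OF s] nn_integral_multc mult.commute)
  have "(\<integral>\<^sup>+x. \<integral>\<^sup>+y. ?h y * ?G x y \<partial>lebesgue \<partial>lebesgue)
      = (\<integral>\<^sup>+y. \<integral>\<^sup>+x. ?h y * ?G x y \<partial>lebesgue \<partial>lebesgue)"
    by (rule Fubini'[symmetric]) (unfold case_prod_beta, measurable)
  also have "\<dots> = ?C * (\<integral>\<^sup>+x. ?h x \<partial>lebesgue)"
    unfolding row[symmetric] by (simp only: gaussian_kernel_commute)
  finally have col: "(\<integral>\<^sup>+x. \<integral>\<^sup>+y. ?h y * ?G x y \<partial>lebesgue \<partial>lebesgue) = ?C * (\<integral>\<^sup>+x. ?h x \<partial>lebesgue)" .
  have "(\<integral>\<^sup>+x. \<integral>\<^sup>+y. ennreal (norm (u x) * norm (u y) * gaussian_kernel s (x - y)) \<partial>lebesgue \<partial>lebesgue)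
      \<le> (\<integral>\<^sup>+x. \<integral>\<^sup>+y. ?h x * ?G x y + ?h y * ?G x y \<partial>lebesgue \<partial>lebesgue)"
    by (intro nn_integral_mono amgm)
  also have "\<dots> = (\<integral>\<^sup>+x. \<integral>\<^sup>+y. ?h x * ?G x y \<partial>lebesgue \<partial>lebesgue)
      + (\<integral>\<^sup>+x. \<integral>\<^sup>+y. ?h y * ?G x y \<partial>lebesgue \<partial>lebesgue)"
    by (subst nn_integral_add[symmetric]) (auto intro!: nn_integral_cong nn_integral_add simp: case_prod_beta)
  also have "\<dots> = ?C * (\<integral>\<^sup>+x. ?h x + ?h x \<partial>lebesgue)"
    unfolding row col by (subst nn_integral_add) (auto simp: distrib_left)
  also have "(\<lambda>x. ?h x + ?h x) = (\<lambda>x. ennreal ((norm (u x))\<^sup>2))"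
    by (simp flip: ennreal_plus)
  finally show ?thesis .
qed

text \<open>
  The damping makes every integral absolutely convergent. With \<open>h = gaussian s \<cdot> cnj (u^)\<close> the
  multiplication formula turns \<open>\<integral> u^ h\<close> into \<open>\<integral> u h^\<close>, and a second application, to a modulated
  Gaussian, identifies \<open>h^\<close> as the conjugate of \<open>u\<close> convolved with the Gaussian kernel.
\<close>

lemma nn_integral_gaussian_fourier_le:
  fixes u :: "'a::euclidean_space \<Rightarrow> complex"
  assumes u: "integrable lebesgue u" and s: "0 < s"
  shows "(\<integral>\<^sup>+\<xi>. ennreal (gaussian s \<xi> * (norm (fourier u \<xi>))\<^sup>2) \<partial>lebesgue)
    \<le> ennreal ((2 * pi) ^ DIM('a)) * (\<integral>\<^sup>+x. ennreal ((norm (u x))\<^sup>2) \<partial>lebesgue)"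
proof -
  have [measurable]: "u \<in> borel_measurable lebesgue"
    using u by (auto dest: borel_measurable_integrable)
  have [measurable]: "gaussian s \<in> borel_measurable (lebesgue :: 'a measure)"
    by (rule measurable_completion) simp
  have bounded_times_gaussian: "integrable lebesgue (\<lambda>\<xi>. of_real (gaussian s \<xi>) * w \<xi>)"
    if [measurable]: "w \<in> borel_measurable lebesgue" and w: "\<And>\<xi>. norm (w \<xi>) \<le> B"
    for w :: "'a \<Rightarrow> complex" and B
  proof (rule Bochner_Integration.integrable_bound)
    show "integrable lebesgue (\<lambda>\<xi>::'a. B * gaussian s \<xi>)"
      using fourier_gaussian(1)[OF s, where ?'a='a] by (intro integrable_mult_right)
    have "norm (w \<xi>) * gaussian s \<xi> \<le> \<bar>B\<bar> * gaussian s \<xi>" for \<xi>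
      using order_trans[OF w abs_ge_self, of \<xi>] by (intro mult_right_mono) (auto simp: gaussian_def)
    then show "AE \<xi> in lebesgue. norm (of_real (gaussian s \<xi>) * w \<xi>) \<le> norm (B * gaussian s \<xi>)"
      by (auto simp: norm_mult abs_mult gaussian_def mult.commute)
  qed measurable
  let ?h = "\<lambda>\<xi>. of_real (gaussian s \<xi>) * cnj (fourier u \<xi>)"
  have h: "integrable lebesgue ?h"
    by (rule bounded_times_gaussian) (auto intro!: norm_fourier_le)
  have fourier_h: "fourier ?h x = cnj (\<integral>y. u y * of_real (gaussian_kernel s (y - x)) \<partial>lebesgue)" for x
  proof -
    \<comment> \<open>the modulation moves the Gaussian kernel from the origin to \<open>x\<close>\<close>
    let ?k = "\<lambda>\<xi>. of_real (gaussian s \<xi>) * exp (\<i> * complex_of_real (\<xi> \<bullet> x))"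
    have k: "integrable lebesgue ?k"
      by (rule bounded_times_gaussian[where B=1]) (auto simp: norm_exp_eq_Re)
    have fk: "fourier ?k y = of_real (gaussian_kernel s (y - x))" for y
    proof -
      have "fourier ?k y = fourier (\<lambda>\<xi>. of_real (gaussian s \<xi>)) (y - x)"
        unfolding fourier_def
        by (intro Bochner_Integration.integral_cong refl)
          (simp add: inner_diff_right algebra_simps flip: exp_add)
      then show ?thesis by (simp add: fourier_gaussian(2)[OF s])
    qed
    have "fourier ?h x = (\<integral>\<xi>. cnj (fourier u \<xi> * ?k \<xi>) \<partial>lebesgue)"
      unfolding fourier_def[of ?h]
      by (intro Bochner_Integration.integral_cong refl) (simp add: exp_cnj mult_ac)
    also have "\<dots> = cnj (\<integral>\<xi>. fourier u \<xi> * ?k \<xi> \<partial>lebesgue)"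
      by (rule Bochner_Integration.integral_cnj)
    also have "(\<integral>\<xi>. fourier u \<xi> * ?k \<xi> \<partial>lebesgue) = (\<integral>y. u y * of_real (gaussian_kernel s (y - x)) \<partial>lebesgue)"
      by (simp add: fourier_multiplication_formula[OF u k] fk)
    finally show ?thesis .
  qed
  have norm_h: "fourier u \<xi> * ?h \<xi> = of_real (gaussian s \<xi> * (norm (fourier u \<xi>))\<^sup>2)" for \<xi>
    using complex_norm_square[of "fourier u \<xi>"] by (simp add: mult_ac)
  have "integrable lebesgue (\<lambda>\<xi>. of_real (gaussian s \<xi>) * of_real ((norm (fourier u \<xi>))\<^sup>2) :: complex)"
    by (rule bounded_times_gaussian[where B="(\<integral>x. norm (u x) \<partial>lebesgue)\<^sup>2"])
      (auto simp: norm_power intro!: norm_fourier_le power_mono)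
  then have int: "integrable lebesgue (\<lambda>\<xi>. gaussian s \<xi> * (norm (fourier u \<xi>))\<^sup>2)"
    by (simp only: complex_of_real_integrable_eq flip: of_real_mult)
  have "(\<integral>\<^sup>+\<xi>. ennreal (gaussian s \<xi> * (norm (fourier u \<xi>))\<^sup>2) \<partial>lebesgue)
      = ennreal (\<integral>\<xi>. gaussian s \<xi> * (norm (fourier u \<xi>))\<^sup>2 \<partial>lebesgue)"
    by (rule nn_integral_eq_integral[OF int]) (auto simp: gaussian_def)
  also have "(\<integral>\<xi>. gaussian s \<xi> * (norm (fourier u \<xi>))\<^sup>2 \<partial>lebesgue)
      \<le> norm (\<integral>\<xi>. fourier u \<xi> * ?h \<xi> \<partial>lebesgue)"
    unfolding norm_h integral_complex_of_real norm_of_real by (rule abs_ge_self)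
  also have "(\<integral>\<xi>. fourier u \<xi> * ?h \<xi> \<partial>lebesgue) = (\<integral>x. u x * fourier ?h x \<partial>lebesgue)"
    by (rule fourier_multiplication_formula[OF u h])
  also have "ennreal (norm (\<integral>x. u x * fourier ?h x \<partial>lebesgue))
      \<le> (\<integral>\<^sup>+x. ennreal (norm (u x * fourier ?h x)) \<partial>lebesgue)"
    by (rule norm_integral_le_nn_integral)
  also have "\<dots> \<le> (\<integral>\<^sup>+x. \<integral>\<^sup>+y. ennreal (norm (u x) * norm (u y) * gaussian_kernel s (x - y)) \<partial>lebesgue \<partial>lebesgue)"
  proof (rule nn_integral_mono)
    fix x :: 'a
    have "ennreal (norm (u x * fourier ?h x))
        = ennreal (norm (u x)) * ennreal (norm (\<integral>y. u y * of_real (gaussian_kernel s (y - x)) \<partial>lebesgue))"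
      unfolding fourier_h by (simp add: norm_mult ennreal_mult)
    also have "\<dots> \<le> ennreal (norm (u x)) *
        (\<integral>\<^sup>+y. ennreal (norm (u y * of_real (gaussian_kernel s (y - x)))) \<partial>lebesgue)"
      by (intro mult_left_mono norm_integral_le_nn_integral) auto
    also have "\<dots> = (\<integral>\<^sup>+y. ennreal (norm (u x) * norm (u y) * gaussian_kernel s (x - y)) \<partial>lebesgue)"
      by (subst nn_integral_cmult[symmetric])
        (auto intro!: nn_integral_cong simp: norm_mult gaussian_kernel_nonneg ennreal_mult mult.assoc
          gaussian_kernel_commute[of s x])
    finally show "ennreal (norm (u x * fourier ?h x))
      \<le> (\<integral>\<^sup>+y. ennreal (norm (u x) * norm (u y) * gaussian_kernel s (x - y)) \<partial>lebesgue)" .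
  qed
  also have "\<dots> \<le> ennreal ((2 * pi) ^ DIM('a)) * (\<integral>\<^sup>+x. ennreal ((norm (u x))\<^sup>2) \<partial>lebesgue)"
    by (rule gaussian_kernel_schur[OF s]) measurable
  finally show ?thesis by (simp add: ennreal_leI)
qed

text \<open>
  The inequality half of Plancherel's theorem for integrable functions: by Fatou's lemma the
  damping can be removed in the limit \<open>s \<rightarrow> 0\<close>. The right-hand side may be infinite.
\<close>

lemma nn_integral_fourier_power2_le:
  fixes u :: "'a::euclidean_space \<Rightarrow> complex"
  assumes u: "integrable lebesgue u"
  shows "(\<integral>\<^sup>+\<xi>. ennreal ((norm (fourier u \<xi>))\<^sup>2) \<partial>lebesgue)
    \<le> ennreal ((2 * pi) ^ DIM('a)) * (\<integral>\<^sup>+x. ennreal ((norm (u x))\<^sup>2) \<partial>lebesgue)"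
proof -
  let ?g = "\<lambda>n::nat. gaussian (inverse (real (Suc n)))"
  have [measurable]: "u \<in> borel_measurable lebesgue"
    using u by (auto dest: borel_measurable_integrable)
  have [measurable]: "?g n \<in> borel_measurable (lebesgue :: 'a measure)" for n
    by (rule measurable_completion) simp
  have "(\<lambda>n. ennreal (?g n \<xi> * (norm (fourier u \<xi>))\<^sup>2)) \<longlonglongrightarrow> ennreal ((norm (fourier u \<xi>))\<^sup>2)" for \<xi>
  proof -
    have "(\<lambda>n. exp (- ((inverse (real (Suc n)))\<^sup>2 * (norm \<xi>)\<^sup>2) / 2)) \<longlonglongrightarrow> exp (- (0\<^sup>2 * (norm \<xi>)\<^sup>2) / 2)"
      by (intro tendsto_intros LIMSEQ_inverse_real_of_nat) simp
    then have "(\<lambda>n. ?g n \<xi>) \<longlonglongrightarrow> 1"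
      by (simp add: gaussian_def)
    then have "(\<lambda>n. ?g n \<xi> * (norm (fourier u \<xi>))\<^sup>2) \<longlonglongrightarrow> 1 * (norm (fourier u \<xi>))\<^sup>2"
      by (intro tendsto_intros)
    then show ?thesis by simp
  qed
  then have "(\<integral>\<^sup>+\<xi>. ennreal ((norm (fourier u \<xi>))\<^sup>2) \<partial>lebesgue)
      = (\<integral>\<^sup>+\<xi>. liminf (\<lambda>n. ennreal (?g n \<xi> * (norm (fourier u \<xi>))\<^sup>2)) \<partial>lebesgue)"
    by (intro nn_integral_cong lim_imp_Liminf[symmetric]) auto
  also have "\<dots> \<le> liminf (\<lambda>n. \<integral>\<^sup>+\<xi>. ennreal (?g n \<xi> * (norm (fourier u \<xi>))\<^sup>2) \<partial>lebesgue)"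
    by (rule nn_integral_liminf) measurable
  also have "\<dots> \<le> ennreal ((2 * pi) ^ DIM('a)) * (\<integral>\<^sup>+x. ennreal ((norm (u x))\<^sup>2) \<partial>lebesgue)"
    by (intro Liminf_le always_eventually allI nn_integral_gaussian_fourier_le u) auto
  finally show ?thesis .
qed

section \<open>The inner product of square-integrable functions\<close>

lemma integrable_mult_cnj:
  assumes u: "u \<in> L2 \<Omega>" and v: "v \<in> L2 \<Omega>"
  shows "integrable (lebesgue_on \<Omega>) (\<lambda>x. u x * cnj (v x))"
proof (rule Bochner_Integration.integrable_bound)
  show "integrable (lebesgue_on \<Omega>) (\<lambda>x. (norm (u x))\<^sup>2 + (norm (v x))\<^sup>2)"
    using u v by (auto simp: L2_def)
  have [measurable]: "u \<in> borel_measurable (lebesgue_on \<Omega>)" "v \<in> borel_measurable (lebesgue_on \<Omega>)"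
    using u v by (auto simp: L2_def)
  show "(\<lambda>x. u x * cnj (v x)) \<in> borel_measurable (lebesgue_on \<Omega>)" by measurable
  have "norm (u x) * norm (v x) \<le> (norm (u x))\<^sup>2 + (norm (v x))\<^sup>2" for x
    using sum_squares_bound[of "norm (u x)" "norm (v x)"]
      mult_nonneg_nonneg[OF norm_ge_zero norm_ge_zero, of "u x" "v x"] by linarith
  then show "AE x in lebesgue_on \<Omega>. norm (u x * cnj (v x)) \<le> norm ((norm (u x))\<^sup>2 + (norm (v x))\<^sup>2)"
    by (auto simp: norm_mult)
qed

lemma L2_zero: "(\<lambda>x. 0) \<in> L2 \<Omega>"
  by (simp add: L2_def)

lemma L2_cmult:
  assumes "u \<in> L2 \<Omega>"
  shows "(\<lambda>x. c * u x) \<in> L2 \<Omega>"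
  using assms by (auto simp: L2_def norm_mult power_mult_distrib)

lemma L2_add:
  assumes u: "u \<in> L2 \<Omega>" and v: "v \<in> L2 \<Omega>"
  shows "(\<lambda>x. u x + v x) \<in> L2 \<Omega>"
proof -
  have [measurable]: "u \<in> borel_measurable (lebesgue_on \<Omega>)" "v \<in> borel_measurable (lebesgue_on \<Omega>)"
    using u v by (auto simp: L2_def)
  have "integrable (lebesgue_on \<Omega>) (\<lambda>x. (norm (u x + v x))\<^sup>2)"
  proof (rule Bochner_Integration.integrable_bound)
    show "integrable (lebesgue_on \<Omega>) (\<lambda>x. 2 * (norm (u x))\<^sup>2 + 2 * (norm (v x))\<^sup>2)"
      using u v by (auto simp: L2_def)
    have "(norm (u x + v x))\<^sup>2 \<le> 2 * (norm (u x))\<^sup>2 + 2 * (norm (v x))\<^sup>2" for x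
    proof -
      have "(norm (u x + v x))\<^sup>2 \<le> (norm (u x) + norm (v x))\<^sup>2"
        by (intro power_mono norm_triangle_ineq) simp
      also have "\<dots> \<le> 2 * (norm (u x))\<^sup>2 + 2 * (norm (v x))\<^sup>2"
        using sum_squares_bound[of "norm (u x)" "norm (v x)"] by (simp add: power2_sum)
      finally show ?thesis .
    qed
    then show "AE x in lebesgue_on \<Omega>. norm ((norm (u x + v x))\<^sup>2)
        \<le> norm (2 * (norm (u x))\<^sup>2 + 2 * (norm (v x))\<^sup>2)"
      by auto
  qed measurable
  then show ?thesis by (simp add: L2_def)
qed

lemma L2_diff:
  assumes u: "u \<in> L2 \<Omega>" and v: "v \<in> L2 \<Omega>"
  shows "(\<lambda>x. u x - v x) \<in> L2 \<Omega>"
  using L2_add[OF u L2_cmult[OF v, of "-1"]] by simp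

lemma L2_sum:
  assumes "\<And>i. i \<in> I \<Longrightarrow> u i \<in> L2 \<Omega>"
  shows "(\<lambda>x. \<Sum>i\<in>I. c i * u i x) \<in> L2 \<Omega>"
  using assms
  by (induction I rule: infinite_finite_induct) (auto intro!: L2_zero L2_add L2_cmult)

lemma l2_inner_cnj: "l2_inner \<Omega> u v = cnj (l2_inner \<Omega> v u)"
  unfolding l2_inner_def by (simp add: mult.commute flip: Bochner_Integration.integral_cnj)

lemma l2_inner_cmult_left: "l2_inner \<Omega> (\<lambda>x. c * u x) v = c * l2_inner \<Omega> u v"
  by (simp add: l2_inner_def mult.assoc)

lemma l2_inner_cmult_right: "l2_inner \<Omega> u (\<lambda>x. c * v x) = cnj c * l2_inner \<Omega> u v"
  by (subst (1 2) l2_inner_cnj) (simp add: l2_inner_cmult_left)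

lemma l2_inner_diff_left:
  assumes "u \<in> L2 \<Omega>" "v \<in> L2 \<Omega>" "w \<in> L2 \<Omega>"
  shows "l2_inner \<Omega> (\<lambda>x. u x - v x) w = l2_inner \<Omega> u w - l2_inner \<Omega> v w"
  using assms by (simp add: l2_inner_def left_diff_distrib integrable_mult_cnj)

lemma l2_inner_diff_right:
  assumes "u \<in> L2 \<Omega>" "v \<in> L2 \<Omega>" "w \<in> L2 \<Omega>"
  shows "l2_inner \<Omega> w (\<lambda>x. u x - v x) = l2_inner \<Omega> w u - l2_inner \<Omega> w v"
  using assms by (simp add: l2_inner_def right_diff_distrib integrable_mult_cnj)

lemma l2_inner_sum_left:
  assumes "\<And>i. i \<in> I \<Longrightarrow> u i \<in> L2 \<Omega>" "w \<in> L2 \<Omega>"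
  shows "l2_inner \<Omega> (\<lambda>x. \<Sum>i\<in>I. c i * u i x) w = (\<Sum>i\<in>I. c i * l2_inner \<Omega> (u i) w)"
proof -
  have "l2_inner \<Omega> (\<lambda>x. \<Sum>i\<in>I. c i * u i x) w
      = (\<integral>x. (\<Sum>i\<in>I. c i * (u i x * cnj (w x))) \<partial>lebesgue_on \<Omega>)"
    by (simp add: l2_inner_def sum_distrib_right mult.assoc)
  also have "\<dots> = (\<Sum>i\<in>I. c i * l2_inner \<Omega> (u i) w)"
    using assms by (subst Bochner_Integration.integral_sum) (auto simp: l2_inner_def integrable_mult_cnj)
  finally show ?thesis .
qed

lemma l2_inner_sum_right:
  assumes "\<And>i. i \<in> I \<Longrightarrow> u i \<in> L2 \<Omega>" "w \<in> L2 \<Omega>"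
  shows "l2_inner \<Omega> w (\<lambda>x. \<Sum>i\<in>I. c i * u i x) = (\<Sum>i\<in>I. cnj (c i) * l2_inner \<Omega> w (u i))"
  by (subst (1 2) l2_inner_cnj) (simp add: l2_inner_sum_left assms)

lemma l2_inner_self: "l2_inner \<Omega> u u = of_real (\<integral>x. (norm (u x))\<^sup>2 \<partial>lebesgue_on \<Omega>)"
  unfolding l2_inner_def by (simp add: complex_norm_square[symmetric] flip: integral_complex_of_real)

lemma l2_inner_self_eq_0_iff:
  assumes "u \<in> L2 \<Omega>"
  shows "l2_inner \<Omega> u u = 0 \<longleftrightarrow> (AE x in lebesgue_on \<Omega>. u x = 0)"
  using assms integral_nonneg_eq_0_iff_AE[of "lebesgue_on \<Omega>" "\<lambda>x. (norm (u x))\<^sup>2"]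
  by (simp add: l2_inner_self L2_def)

lemma l2_inner_cong_AE:
  assumes "u \<in> L2 \<Omega>" "u' \<in> L2 \<Omega>" "v \<in> L2 \<Omega>" "AE x in lebesgue_on \<Omega>. u x = u' x"
  shows "l2_inner \<Omega> u v = l2_inner \<Omega> u' v"
  unfolding l2_inner_def
  by (rule integral_cong_AE) (use assms in \<open>auto intro: borel_measurable_integrable integrable_mult_cnj\<close>)

text \<open>
  The orthonormal vectors are exhibited as linear combinations of the given ones, so that they stay
  in any subspace containing these. The new vector is the last \<open>f\<close> minus its projection; its
  coefficient on that \<open>f\<close> is 1 before normalization, so independence prevents it from vanishing almost everywhere.
\<close>

lemma l2_gram_schmidt:
  assumes "\<And>i. i < n \<Longrightarrow> f i \<in> L2 \<Omega>" and "l2_independent \<Omega> n f"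
  shows "\<exists>e C. (\<forall>i<n. e i = (\<lambda>x. \<Sum>j<n. C i j * f j x)) \<and>
    (\<forall>i<n. \<forall>j<n. l2_inner \<Omega> (e i) (e j) = (if i = j then 1 else 0))"
  using assms
proof (induction n)
  case 0
  then show ?case by simp
next
  case (Suc n)
  have f: "f i \<in> L2 \<Omega>" if "i < Suc n" for i using Suc.prems(1) that .
  have "l2_independent \<Omega> n f"
    unfolding l2_independent_def
  proof (intro allI impI)
    fix c i assume *: "AE x in lebesgue_on \<Omega>. (\<Sum>i<n. c i * f i x) = 0" and i: "i < n"
    have "(\<Sum>i<Suc n. (if i = n then 0 else c i) * f i x) = (\<Sum>i<n. c i * f i x)" for x
      by (auto intro!: sum.cong)
    then have "(if i = n then 0 else c i) = 0"
      using * i Suc.prems(2)[unfolded l2_independent_def, rule_format, of "\<lambda>i. if i = n then 0 else c i" i]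
      by simp
    then show "c i = 0" using i by simp
  qed
  then have "\<exists>e C. (\<forall>i<n. e i = (\<lambda>x. \<Sum>j<n. C i j * f j x)) \<and>
    (\<forall>i<n. \<forall>j<n. l2_inner \<Omega> (e i) (e j) = (if i = j then 1 else 0))"
    by (intro Suc.IH f) simp
  then obtain e C where e: "\<And>i. i < n \<Longrightarrow> e i = (\<lambda>x. \<Sum>j<n. C i j * f j x)"
    and on: "\<And>i j. i < n \<Longrightarrow> j < n \<Longrightarrow> l2_inner \<Omega> (e i) (e j) = (if i = j then 1 else 0)"
    by blast
  have eL: "e i \<in> L2 \<Omega>" if "i < n" for i
    unfolding e[OF that] by (rule L2_sum) (simp add: f)
  define a where "a i = l2_inner \<Omega> (f n) (e i)" for i
  define w where "w = (\<lambda>x. f n x - (\<Sum>i<n. a i * e i x))"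
  \<comment> \<open>the coefficients of \<open>w\<close> in terms of the \<open>f j\<close>\<close>
  define d where "d j = (if j = n then 1 else - (\<Sum>i<n. a i * C i j))" for j
  have PL: "(\<lambda>x. \<Sum>i<n. a i * e i x) \<in> L2 \<Omega>"
    by (rule L2_sum) (simp add: eL)
  have wL: "w \<in> L2 \<Omega>"
    unfolding w_def by (intro L2_diff PL f) simp
  have w_orth: "l2_inner \<Omega> w (e j) = 0" if j: "j < n" for j
  proof -
    have "l2_inner \<Omega> w (e j) = a j - (\<Sum>i<n. a i * l2_inner \<Omega> (e i) (e j))"
      using l2_inner_diff_left[OF f[of n] PL eL[OF j]]
        l2_inner_sum_left[of "{..<n}" e \<Omega> "e j" a, OF eL eL[OF j]]
      by (simp add: w_def a_def)
    also have "(\<Sum>i<n. a i * l2_inner \<Omega> (e i) (e j)) = (\<Sum>i<n. if i = j then a i else 0)"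
      using j by (intro sum.cong) (auto simp: on)
    finally show ?thesis using j by simp
  qed
  have w_comb: "w x = (\<Sum>j<Suc n. d j * f j x)" for x
  proof -
    have "(\<Sum>i<n. a i * e i x) = (\<Sum>i<n. \<Sum>j<n. a i * C i j * f j x)"
      by (simp add: e sum_distrib_left mult.assoc)
    also have "\<dots> = (\<Sum>j<n. (\<Sum>i<n. a i * C i j) * f j x)"
      by (subst sum.swap) (simp add: sum_distrib_right)
    finally show ?thesis by (simp add: w_def d_def sum_negf)
  qed
  define r where "r = (\<integral>x. (norm (w x))\<^sup>2 \<partial>lebesgue_on \<Omega>)"
  have r_eq: "l2_inner \<Omega> w w = of_real r" by (simp add: l2_inner_self r_def)
  have "r \<noteq> 0"
  proof
    assume "r = 0"
    then have "AE x in lebesgue_on \<Omega>. w x = 0"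
      using l2_inner_self_eq_0_iff[OF wL] r_eq by simp
    then have "d n = 0"
      using Suc.prems(2)[unfolded l2_independent_def, rule_format, of d n] by (simp only: w_comb lessI)
    then show False by (simp add: d_def)
  qed
  then have r: "r > 0" unfolding r_def by (simp add: order_less_le integral_nonneg_AE)
  define s where "s = complex_of_real (inverse (sqrt r))"
  have s: "s * (cnj s * of_real r) = 1"
  proof -
    have "inverse (sqrt r) * (inverse (sqrt r) * r) = 1"
      using r by (simp add: field_simps)
    then show ?thesis
      unfolding s_def complex_cnj_complex_of_real by (simp only: of_real_1 flip: of_real_mult)
  qed
  define e' where "e' = e(n := (\<lambda>x. s * w x))"
  define C' where "C' i j = (if i = n then s * d j else if j = n then 0 else C i j)" for i j
  have "e' i = (\<lambda>x. \<Sum>j<Suc n. C' i j * f j x)" if "i < Suc n" for i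
  proof (cases "i = n")
    case True
    have "s * (\<Sum>j<Suc n. d j * f j x) = (\<Sum>j<Suc n. s * d j * f j x)" for x
      by (simp only: sum_distrib_left mult.assoc)
    with True show ?thesis by (simp add: e'_def C'_def w_comb del: sum.lessThan_Suc)
  next
    case False
    then have i: "i < n" using that by simp
    have "(\<Sum>j<Suc n. C' i j * f j x) = (\<Sum>j<n. C i j * f j x)" for x
      using False by (auto simp: C'_def intro!: sum.cong)
    with False show ?thesis by (simp add: e'_def e[OF i] del: sum.lessThan_Suc)
  qed
  moreover have "l2_inner \<Omega> (e' i) (e' j) = (if i = j then 1 else 0)" if "i < Suc n" "j < Suc n" for i j
  proof -
    have w_orth': "l2_inner \<Omega> (e j) w = 0" if "j < n" for j
      using w_orth[OF that] by (subst l2_inner_cnj) simp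
    consider "i < n" "j < n" | "i = n" "j < n" | "i < n" "j = n" | "i = n" "j = n"
      using \<open>i < Suc n\<close> \<open>j < Suc n\<close> by linarith
    then show ?thesis
      by cases (auto simp: e'_def on l2_inner_cmult_left l2_inner_cmult_right w_orth w_orth' r_eq s)
  qed
  ultimately show ?case by blast
qed

text \<open>
  The residual of \<open>v\<close> after projection has squared norm equal to the difference of the two sides.
\<close>

lemma l2_bessel:
  assumes F: "finite F" and u: "\<And>k. k \<in> F \<Longrightarrow> u k \<in> L2 \<Omega>" and v: "v \<in> L2 \<Omega>"
    and on: "\<And>j k. j \<in> F \<Longrightarrow> k \<in> F \<Longrightarrow> l2_inner \<Omega> (u j) (u k) = (if j = k then 1 else 0)"
  shows "(\<Sum>k\<in>F. (norm (l2_inner \<Omega> v (u k)))\<^sup>2) \<le> (\<integral>x. (norm (v x))\<^sup>2 \<partial>lebesgue_on \<Omega>)"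
proof -
  define a where "a k = l2_inner \<Omega> v (u k)" for k
  define p where "p = (\<lambda>x. \<Sum>k\<in>F. a k * u k x)"
  define w where "w = (\<lambda>x. v x - p x)"
  have pL: "p \<in> L2 \<Omega>" unfolding p_def by (rule L2_sum) (rule u)
  have wL: "w \<in> L2 \<Omega>" unfolding w_def by (intro L2_diff v pL)
  have w_orth: "l2_inner \<Omega> w (u j) = 0" if j: "j \<in> F" for j
  proof -
    have "l2_inner \<Omega> w (u j) = a j - (\<Sum>k\<in>F. a k * l2_inner \<Omega> (u k) (u j))"
      unfolding w_def using l2_inner_diff_left[OF v pL u[OF j]]
      by (simp add: p_def a_def l2_inner_sum_left u j)
    also have "(\<Sum>k\<in>F. a k * l2_inner \<Omega> (u k) (u j)) = (\<Sum>k\<in>F. if k = j then a k else 0)"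
      using j by (intro sum.cong) (auto simp: on)
    finally show ?thesis using j F by simp
  qed
  have "l2_inner \<Omega> w w = l2_inner \<Omega> w v - l2_inner \<Omega> w p"
    using l2_inner_diff_right[OF v pL wL] by (simp add: w_def)
  also have "l2_inner \<Omega> w p = 0"
    unfolding p_def by (simp add: l2_inner_sum_right u wL w_orth)
  also have "l2_inner \<Omega> w v = l2_inner \<Omega> v v - (\<Sum>k\<in>F. a k * l2_inner \<Omega> (u k) v)"
    unfolding w_def using l2_inner_diff_left[OF v pL v] by (simp add: p_def l2_inner_sum_left u v)
  also have "(\<Sum>k\<in>F. a k * l2_inner \<Omega> (u k) v) = of_real (\<Sum>k\<in>F. (norm (a k))\<^sup>2)"
  proof -
    have "a k * l2_inner \<Omega> (u k) v = of_real ((norm (a k))\<^sup>2)" for k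
      by (subst l2_inner_cnj) (simp only: a_def complex_norm_square)
    then show ?thesis by simp
  qed
  finally have "complex_of_real (\<integral>x. (norm (w x))\<^sup>2 \<partial>lebesgue_on \<Omega>)
      = of_real ((\<integral>x. (norm (v x))\<^sup>2 \<partial>lebesgue_on \<Omega>) - (\<Sum>k\<in>F. (norm (a k))\<^sup>2))"
    by (simp add: l2_inner_self)
  then have "(\<integral>x. (norm (w x))\<^sup>2 \<partial>lebesgue_on \<Omega>)
      = (\<integral>x. (norm (v x))\<^sup>2 \<partial>lebesgue_on \<Omega>) - (\<Sum>k\<in>F. (norm (a k))\<^sup>2)"
    by (simp only: of_real_eq_iff)
  moreover have "0 \<le> (\<integral>x. (norm (w x))\<^sup>2 \<partial>lebesgue_on \<Omega>)" by simp
  ultimately show ?thesis by (simp add: a_def)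
qed

section \<open>Orthonormal eigenfunctions of a self-adjoint operator\<close>

text \<open>
  The operator is only known up to null sets and its linearity is not given. Moving it to the other
  factor makes the eigenvalue equation visibly linear in \<open>u\<close>, so that eigenspaces turn out to be
  closed under linear combinations.
\<close>

lemma eigenspace_iff_weak:
  assumes A: "\<And>u. u \<in> L2 \<Omega> \<Longrightarrow> A u \<in> L2 \<Omega>" and sa: "l2_selfadjoint \<Omega> A" and u: "u \<in> L2 \<Omega>"
  shows "u \<in> eigenspace \<Omega> A \<mu> \<longleftrightarrow> (\<forall>w\<in>L2 \<Omega>. l2_inner \<Omega> u (A w) = of_real \<mu> * l2_inner \<Omega> u w)"
proof
  assume "u \<in> eigenspace \<Omega> A \<mu>"
  then have "AE x in lebesgue_on \<Omega>. A u x = of_real \<mu> * u x" by (simp add: eigenspace_def)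
  then have "l2_inner \<Omega> (A u) w = of_real \<mu> * l2_inner \<Omega> u w" if "w \<in> L2 \<Omega>" for w
    using l2_inner_cong_AE[OF A[OF u] L2_cmult[OF u] that] by (simp add: l2_inner_cmult_left)
  then show "\<forall>w\<in>L2 \<Omega>. l2_inner \<Omega> u (A w) = of_real \<mu> * l2_inner \<Omega> u w"
    using sa u by (simp add: l2_selfadjoint_def)
next
  assume weak: "\<forall>w\<in>L2 \<Omega>. l2_inner \<Omega> u (A w) = of_real \<mu> * l2_inner \<Omega> u w"
  define g where "g = (\<lambda>x. A u x - of_real \<mu> * u x)"
  have g: "g \<in> L2 \<Omega>" unfolding g_def by (intro L2_diff A L2_cmult u)
  have "l2_inner \<Omega> g g = l2_inner \<Omega> (A u) g - of_real \<mu> * l2_inner \<Omega> u g"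
    using l2_inner_diff_left[OF A[OF u] L2_cmult[OF u] g] by (simp add: g_def l2_inner_cmult_left)
  also have "\<dots> = 0"
    using sa weak u g by (simp add: l2_selfadjoint_def)
  finally have "AE x in lebesgue_on \<Omega>. g x = 0"
    by (simp add: l2_inner_self_eq_0_iff[OF g])
  then show "u \<in> eigenspace \<Omega> A \<mu>"
    using u by (simp add: eigenspace_def g_def)
qed

lemma eigenspace_sum:
  assumes A: "\<And>u. u \<in> L2 \<Omega> \<Longrightarrow> A u \<in> L2 \<Omega>" and sa: "l2_selfadjoint \<Omega> A"
    and f: "\<And>i. i \<in> I \<Longrightarrow> f i \<in> eigenspace \<Omega> A \<mu>"
  shows "(\<lambda>x. \<Sum>i\<in>I. c i * f i x) \<in> eigenspace \<Omega> A \<mu>"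
proof -
  have fL: "f i \<in> L2 \<Omega>" if "i \<in> I" for i using f[OF that] by (simp add: eigenspace_def)
  have "l2_inner \<Omega> (f i) (A w) = of_real \<mu> * l2_inner \<Omega> (f i) w" if "i \<in> I" "w \<in> L2 \<Omega>" for i w
    using eigenspace_iff_weak[OF A sa fL] f that by blast
  then show ?thesis
    by (subst eigenspace_iff_weak[OF A sa])
      (auto simp: L2_sum l2_inner_sum_left fL A sum_distrib_left mult_ac intro!: sum.cong)
qed

lemma eigenspaces_orthogonal:
  assumes A: "\<And>u. u \<in> L2 \<Omega> \<Longrightarrow> A u \<in> L2 \<Omega>" and sa: "l2_selfadjoint \<Omega> A"
    and u: "u \<in> eigenspace \<Omega> A \<mu>" and v: "v \<in> eigenspace \<Omega> A \<nu>" and "\<mu> \<noteq> \<nu>"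
  shows "l2_inner \<Omega> u v = 0"
proof -
  have L: "u \<in> L2 \<Omega>" "v \<in> L2 \<Omega>" using u v by (auto simp: eigenspace_def)
  have "of_real \<mu> * l2_inner \<Omega> u v = l2_inner \<Omega> u (A v)"
    using eigenspace_iff_weak[OF A sa L(1)] u L by simp
  also have "\<dots> = l2_inner \<Omega> (A u) v"
    using sa L by (simp add: l2_selfadjoint_def)
  also have "\<dots> = cnj (l2_inner \<Omega> v (A u))"
    by (rule l2_inner_cnj)
  also have "l2_inner \<Omega> v (A u) = of_real \<nu> * l2_inner \<Omega> v u"
    using eigenspace_iff_weak[OF A sa L(2)] v L by simp
  also have "cnj \<dots> = of_real \<nu> * l2_inner \<Omega> u v"
    by (subst (2) l2_inner_cnj) simp
  finally show ?thesis using \<open>\<mu> \<noteq> \<nu>\<close> by simp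
qed

text \<open>
  A finite supremum of a nonempty set of extended naturals is a maximum; the set is nonempty because
  the empty family is independent.
\<close>

lemma multiplicity_attained:
  assumes "multiplicity \<Omega> A \<mu> = enat m"
  shows "\<exists>f. (\<forall>i<m. f i \<in> eigenspace \<Omega> A \<mu>) \<and> l2_independent \<Omega> m f"
proof -
  let ?N = "{n. \<exists>f. (\<forall>i<n. f i \<in> eigenspace \<Omega> A \<mu>) \<and> l2_independent \<Omega> n f}"
  have "0 \<in> ?N" by (simp add: l2_independent_def)
  then have ne: "enat ` ?N \<noteq> {}" by blast
  have Sup: "Sup (enat ` ?N) = enat m" using assms by (simp add: multiplicity_def)
  have fin: "finite (enat ` ?N)" using Sup ne by (auto simp: Sup_enat_def split: if_splits)
  have "Max (enat ` ?N) = enat m"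
    using Sup unfolding Sup_enat_def if_not_P[OF ne] if_P[OF fin] .
  then have "enat m \<in> enat ` ?N" using Max_in[OF fin ne] by metis
  then show ?thesis by auto
qed

text \<open>
  For each \<open>\<mu>\<close> in \<open>S\<close> the indices \<open>k\<close> with \<open>ev k = \<mu>\<close> are as many as the dimension of the eigenspace, so they
  can label an orthonormal family in it.
\<close>

lemma orthonormal_eigenfunctions:
  fixes \<Omega> :: "'a::euclidean_space set"
  assumes A: "\<And>u. u \<in> L2 \<Omega> \<Longrightarrow> A u \<in> L2 \<Omega>" and sa: "l2_selfadjoint \<Omega> A"
    and enum: "enumerates_eigenvalues \<Omega> A S K ev"
  shows "\<exists>u. (\<forall>k\<in>K. u k \<in> eigenspace \<Omega> A (ev k)) \<and>
    (\<forall>j\<in>K. \<forall>k\<in>K. l2_inner \<Omega> (u j) (u k) = (if j = k then 1 else 0))"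
proof -
  define P where "P \<mu> u \<longleftrightarrow> (\<forall>k\<in>K. ev k = \<mu> \<longrightarrow> u k \<in> eigenspace \<Omega> A \<mu>) \<and>
      (\<forall>j\<in>K. \<forall>k\<in>K. ev j = \<mu> \<longrightarrow> ev k = \<mu> \<longrightarrow> l2_inner \<Omega> (u j) (u k) = (if j = k then 1 else 0))"
    for \<mu> and u :: "nat \<Rightarrow> 'a \<Rightarrow> complex"
  have "\<exists>u. P \<mu> u"
    if "\<mu> \<in> S" for \<mu>
  proof -
    let ?J = "{k\<in>K. ev k = \<mu>}"
    have fin: "finite ?J" and mult: "multiplicity \<Omega> A \<mu> = enat (card ?J)"
      using enum that by (auto simp: enumerates_eigenvalues_def)
    obtain f where f: "\<And>i. i < card ?J \<Longrightarrow> f i \<in> eigenspace \<Omega> A \<mu>" "l2_independent \<Omega> (card ?J) f"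
      using multiplicity_attained[OF mult] by blast
    have fL: "f i \<in> L2 \<Omega>" if "i < card ?J" for i using f(1)[OF that] by (simp add: eigenspace_def)
    obtain e C where e: "\<And>i. i < card ?J \<Longrightarrow> e i = (\<lambda>x. \<Sum>j<card ?J. C i j * f j x)"
      and on: "\<And>i j. i < card ?J \<Longrightarrow> j < card ?J \<Longrightarrow> l2_inner \<Omega> (e i) (e j) = (if i = j then 1 else 0)"
      using l2_gram_schmidt[OF fL f(2)] by blast
    have eE: "e i \<in> eigenspace \<Omega> A \<mu>" if "i < card ?J" for i
      unfolding e[OF that] by (rule eigenspace_sum[OF A sa]) (auto intro: f(1))
    obtain h where h: "bij_betw h ?J {0..<card ?J}"
      using ex_bij_betw_finite_nat[OF fin] by blast
    have hlt: "h k < card ?J" if "k \<in> ?J" for k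
      using bij_betwE[OF h] that by auto
    have hinj: "h j = h k \<longleftrightarrow> j = k" if "j \<in> ?J" "k \<in> ?J" for j k
      using bij_betw_imp_inj_on[OF h] that by (rule inj_on_eq_iff)
    have "P \<mu> (\<lambda>k. e (h k))"
      using eE on hlt hinj by (simp add: P_def)
    then show ?thesis by blast
  qed
  then have "\<forall>\<mu>\<in>S. \<exists>u. P \<mu> u" by blast
  then obtain U where U: "\<forall>\<mu>\<in>S. P \<mu> (U \<mu>)" by (rule bchoice[THEN exE])
  have S: "ev k \<in> S" if "k \<in> K" for k using enum that by (auto simp: enumerates_eigenvalues_def)
  then have P: "P (ev k) (U (ev k))" if "k \<in> K" for k using U that by blast
  have E: "U (ev k) k \<in> eigenspace \<Omega> A (ev k)" if "k \<in> K" for k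
    using P[OF that] that by (simp add: P_def)
  have "l2_inner \<Omega> (U (ev j) j) (U (ev k) k) = (if j = k then 1 else 0)"
    if jk: "j \<in> K" "k \<in> K" for j k
  proof (cases "ev j = ev k")
    case True
    then show ?thesis using P[OF jk(2)] jk by (simp add: P_def)
  next
    case False
    then have "j \<noteq> k" by blast
    with eigenspaces_orthogonal[OF A sa E[OF jk(1)] E[OF jk(2)] False] show ?thesis by simp
  qed
  with E show ?thesis by (intro exI[of _ "\<lambda>k. U (ev k) k"]) blast
qed

section \<open>Fourier transforms of functions extended by zero\<close>

lemma zero_ext_eq: "zero_ext \<Omega> u x = indicator \<Omega> x *\<^sub>R u x"
  by (simp add: zero_ext_def indicator_def)

lemma finite_measure_lebesgue_on:
  assumes "\<Omega> \<in> sets lebesgue" "emeasure lebesgue \<Omega> < \<infinity>"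
  shows "finite_measure (lebesgue_on \<Omega>)"
  using assms by (intro finite_measureI) (simp add: emeasure_restrict_space)

lemma integrable_zero_ext:
  assumes \<Omega>: "\<Omega> \<in> sets lebesgue" "emeasure lebesgue \<Omega> < \<infinity>" and u: "u \<in> L2 \<Omega>"
  shows "integrable lebesgue (zero_ext \<Omega> u)"
proof -
  interpret finite_measure "lebesgue_on \<Omega>" by (rule finite_measure_lebesgue_on[OF \<Omega>])
  have "integrable (lebesgue_on \<Omega>) u"
  proof (rule Bochner_Integration.integrable_bound)
    show "integrable (lebesgue_on \<Omega>) (\<lambda>x. 1 + (norm (u x))\<^sup>2)"
      using u by (auto simp: L2_def)
    show "u \<in> borel_measurable (lebesgue_on \<Omega>)" using u by (simp add: L2_def)
    have "norm (u x) \<le> 1 + (norm (u x))\<^sup>2" for x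
      using sum_squares_bound[of 1 "norm (u x)"] by simp (smt (verit) norm_ge_zero)
    then show "AE x in lebesgue_on \<Omega>. norm (u x) \<le> norm (1 + (norm (u x))\<^sup>2)"
      by auto
  qed
  then show ?thesis
    using \<Omega> by (subst (asm) integrable_restrict_space) (auto simp: zero_ext_eq[abs_def])
qed

lemma nn_integral_zero_ext_power2:
  assumes \<Omega>: "\<Omega> \<in> sets lebesgue" and u: "u \<in> L2 \<Omega>"
  shows "(\<integral>\<^sup>+x. ennreal ((norm (zero_ext \<Omega> u x))\<^sup>2) \<partial>lebesgue)
    = ennreal (\<integral>x. (norm (u x))\<^sup>2 \<partial>lebesgue_on \<Omega>)"
proof -
  have "(\<integral>\<^sup>+x. ennreal ((norm (zero_ext \<Omega> u x))\<^sup>2) \<partial>lebesgue)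
      = (\<integral>\<^sup>+x. ennreal ((norm (u x))\<^sup>2) * indicator \<Omega> x \<partial>lebesgue)"
    by (intro nn_integral_cong) (simp add: zero_ext_def indicator_def)
  also have "\<dots> = (\<integral>\<^sup>+x. ennreal ((norm (u x))\<^sup>2) \<partial>lebesgue_on \<Omega>)"
    using \<Omega> by (subst nn_integral_restrict_space) auto
  also have "\<dots> = ennreal (\<integral>x. (norm (u x))\<^sup>2 \<partial>lebesgue_on \<Omega>)"
    using u by (intro nn_integral_eq_integral) (auto simp: L2_def)
  finally show ?thesis .
qed

lemma fourier_zero_ext:
  assumes \<Omega>: "\<Omega> \<in> sets lebesgue"
  shows "fourier (zero_ext \<Omega> u) \<xi> = l2_inner \<Omega> u (\<lambda>x. exp (\<i> * complex_of_real (x \<bullet> \<xi>)))"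
proof -
  have "l2_inner \<Omega> u (\<lambda>x. exp (\<i> * complex_of_real (x \<bullet> \<xi>)))
      = (\<integral>x. indicator \<Omega> x *\<^sub>R (u x * cnj (exp (\<i> * complex_of_real (x \<bullet> \<xi>)))) \<partial>lebesgue)"
    unfolding l2_inner_def using \<Omega> by (subst integral_restrict_space) auto
  also have "\<dots> = fourier (zero_ext \<Omega> u) \<xi>"
    unfolding fourier_def zero_ext_eq
    by (intro Bochner_Integration.integral_cong refl) (simp add: exp_cnj)
  finally show ?thesis ..
qed

section \<open>Eigenvalue sums\<close>

text \<open>
  The values of the Fourier transforms at \<open>\<xi>\<close> are, up to conjugation, the coefficients of the plane
  wave \<open>x \<mapsto> e^(i x \<cdot> \<xi>)\<close> in the orthonormal family, and this wave has squared norm \<open>|\<Omega>|\<close>.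
\<close>

lemma sum_fourier_orthonormal_le:
  assumes \<Omega>: "\<Omega> \<in> sets lebesgue" "emeasure lebesgue \<Omega> < \<infinity>" and F: "finite F"
    and u: "\<And>k. k \<in> F \<Longrightarrow> u k \<in> L2 \<Omega>"
    and on: "\<And>j k. j \<in> F \<Longrightarrow> k \<in> F \<Longrightarrow> l2_inner \<Omega> (u j) (u k) = (if j = k then 1 else 0)"
  shows "(\<Sum>k\<in>F. (norm (fourier (zero_ext \<Omega> (u k)) \<xi>))\<^sup>2) \<le> measure lebesgue \<Omega>"
proof -
  interpret finite_measure "lebesgue_on \<Omega>" by (rule finite_measure_lebesgue_on[OF \<Omega>])
  let ?v = "\<lambda>x. exp (\<i> * complex_of_real (x \<bullet> \<xi>))"
  have norm_v: "norm (?v x) = 1" for x by (simp add: norm_exp_eq_Re)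
  have "?v \<in> borel_measurable borel"
    by (intro borel_measurable_continuous_onI continuous_intros)
  then have "?v \<in> borel_measurable lebesgue"
    by (intro measurable_completion) simp
  then have "?v \<in> borel_measurable (lebesgue_on \<Omega>)"
    by (rule measurable_restrict_space1)
  then have v: "?v \<in> L2 \<Omega>" by (simp add: L2_def norm_v del: norm_exp_i_times)
  have "norm (fourier (zero_ext \<Omega> (u k)) \<xi>) = norm (l2_inner \<Omega> ?v (u k))" for k
    unfolding fourier_zero_ext[OF \<Omega>(1)] by (subst l2_inner_cnj) (rule complex_mod_cnj)
  then have "(\<Sum>k\<in>F. (norm (fourier (zero_ext \<Omega> (u k)) \<xi>))\<^sup>2) \<le> (\<integral>x. (norm (?v x))\<^sup>2 \<partial>lebesgue_on \<Omega>)"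
    using l2_bessel[OF F u v on] by (simp only:)
  also have "\<dots> = measure lebesgue \<Omega>"
    using \<Omega> by (simp add: norm_v measure_restrict_space del: norm_exp_i_times)
  finally show ?thesis .
qed

text \<open>
  To be applied with \<open>s\<close> the sign of \<open>\<mu>\<close>, so that \<open>s * \<mu>\<close> is its absolute value. The quadratic form
  expresses \<open>\<mu>\<close> through \<open>q\<close>, and the Plancherel inequality has the right direction because \<open>lam \<ge> 0\<close>
  enters with a minus sign.
\<close>

lemma eigenvalue_excess_le:
  fixes \<Omega> :: "'a::euclidean_space set" and q :: "'a \<Rightarrow> real"
  assumes \<Omega>: "\<Omega> \<in> sets lebesgue" "emeasure lebesgue \<Omega> < \<infinity>"
    and form: "l2_inner \<Omega> (A u) u = (\<integral>\<xi>. complex_of_real (q \<xi>) * fourier (zero_ext \<Omega> u) \<xi>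
        * cnj (fourier (zero_ext \<Omega> u) \<xi>) \<partial>lebesgue) / (2 * pi) ^ DIM('a)"
    and A: "A u \<in> L2 \<Omega>" and u: "u \<in> eigenspace \<Omega> A \<mu>" and unit: "l2_inner \<Omega> u u = 1"
    and pos: "0 < s * \<mu>" and lam: "0 \<le> lam"
  shows "ennreal (s * \<mu> - lam) \<le> ennreal (1 / (2 * pi) ^ DIM('a)) *
    (\<integral>\<^sup>+\<xi>. ennreal (max (s * q \<xi> - lam) 0) * ennreal ((norm (fourier (zero_ext \<Omega> u) \<xi>))\<^sup>2) \<partial>lebesgue)"
proof -
  let ?p = "\<lambda>\<xi>. (norm (fourier (zero_ext \<Omega> u) \<xi>))\<^sup>2"
  define c where "c = (2 * pi) ^ DIM('a)"
  have c: "c > 0" by (simp add: c_def)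
  have uL: "u \<in> L2 \<Omega>" using u by (simp add: eigenspace_def)
  have zi: "integrable lebesgue (zero_ext \<Omega> u)" by (rule integrable_zero_ext[OF \<Omega> uL])
  then have [measurable]: "zero_ext \<Omega> u \<in> borel_measurable lebesgue" by (rule borel_measurable_integrable)
  have norm_u: "(\<integral>x. (norm (u x))\<^sup>2 \<partial>lebesgue_on \<Omega>) = 1"
    using unit unfolding l2_inner_self by (simp only: of_real_eq_1_iff)
  have le_c: "(\<integral>\<^sup>+\<xi>. ennreal (?p \<xi>) \<partial>lebesgue) \<le> ennreal c"
    using nn_integral_fourier_power2_le[OF zi]
    by (simp add: nn_integral_zero_ext_power2[OF \<Omega>(1) uL] norm_u c_def)
  have pi: "integrable lebesgue ?p"
    by (rule integrableI_nonneg) (use le_c in \<open>auto intro: le_less_trans\<close>)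
  have p_le: "(\<integral>\<xi>. ?p \<xi> \<partial>lebesgue) \<le> c"
    using le_c c by (simp add: nn_integral_eq_integral[OF pi])
  have "l2_inner \<Omega> (A u) u = of_real \<mu> * l2_inner \<Omega> u u"
    using l2_inner_cong_AE[OF A L2_cmult[OF uL] uL] u by (simp add: eigenspace_def l2_inner_cmult_left)
  then have "of_real \<mu> = (\<integral>\<xi>. complex_of_real (q \<xi> * ?p \<xi>) \<partial>lebesgue) / (2 * pi) ^ DIM('a)"
    using form unit by (simp add: complex_norm_square mult.assoc del: of_real_power)
  then have "complex_of_real \<mu> = of_real ((\<integral>\<xi>. q \<xi> * ?p \<xi> \<partial>lebesgue) / c)"
    unfolding integral_complex_of_real by (simp add: c_def)
  then have mu: "\<mu> = (\<integral>\<xi>. q \<xi> * ?p \<xi> \<partial>lebesgue) / c"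
    by (simp only: of_real_eq_iff)
  \<comment> \<open>otherwise the integral would be 0 by convention, whereas \<open>\<mu> \<noteq> 0\<close>\<close>
  have qi: "integrable lebesgue (\<lambda>\<xi>. q \<xi> * ?p \<xi>)"
    using pos mu not_integrable_integral_eq by fastforce
  let ?f = "\<lambda>\<xi>. s * (q \<xi> * ?p \<xi>) - lam * ?p \<xi>"
  have fi: "integrable lebesgue ?f" using qi pi by simp
  then have fi': "integrable lebesgue (\<lambda>\<xi>. max (?f \<xi>) 0)" by simp
  have "lam * (\<integral>\<xi>. ?p \<xi> \<partial>lebesgue) \<le> lam * c" by (intro mult_left_mono p_le lam)
  then have "s * \<mu> - lam \<le> (s * (\<integral>\<xi>. q \<xi> * ?p \<xi> \<partial>lebesgue) - lam * (\<integral>\<xi>. ?p \<xi> \<partial>lebesgue)) / c"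
    unfolding mu using c by (simp add: field_simps)
  also have "\<dots> = (\<integral>\<xi>. ?f \<xi> \<partial>lebesgue) / c"
    using qi pi by simp
  also have "\<dots> \<le> (\<integral>\<xi>. max (?f \<xi>) 0 \<partial>lebesgue) / c"
    using c by (intro divide_right_mono integral_mono fi fi') auto
  finally have "ennreal (s * \<mu> - lam) \<le> ennreal (1 / c * (\<integral>\<xi>. max (?f \<xi>) 0 \<partial>lebesgue))"
    by (simp add: ennreal_leI)
  also have "\<dots> = ennreal (1 / c) * (\<integral>\<^sup>+\<xi>. ennreal (max (?f \<xi>) 0) \<partial>lebesgue)"
    unfolding nn_integral_eq_integral[OF fi' AE_I2[OF max.cobounded2]]
    using c by (intro ennreal_mult) (auto intro!: integral_nonneg_AE)
  also have "(\<lambda>\<xi>. ennreal (max (?f \<xi>) 0)) = (\<lambda>\<xi>. ennreal (max (s * q \<xi> - lam) 0) * ennreal (?p \<xi>))"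
  proof
    fix \<xi>
    have "max (?f \<xi>) 0 = max (s * q \<xi> - lam) 0 * ?p \<xi>"
      by (simp add: max_mult_distrib_right algebra_simps)
    then show "ennreal (max (?f \<xi>) 0) = ennreal (max (s * q \<xi> - lam) 0) * ennreal (?p \<xi>)"
      by (simp add: ennreal_mult)
  qed
  finally show ?thesis by (simp add: c_def)
qed

text \<open>
  The bound for eigenvalues of one sign. The infinite sum is the supremum of its finite partial sums,
  so finitely many eigenfunctions at a time suffice.
\<close>

lemma signed_eigenvalue_sum_le:
  fixes \<Omega> :: "'a::euclidean_space set" and q :: "'a \<Rightarrow> real"
  assumes \<Omega>: "\<Omega> \<in> sets lebesgue" "emeasure lebesgue \<Omega> < \<infinity>"
    and q[measurable]: "q \<in> borel_measurable lebesgue"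
    and rep: "represented_by (fourier_distr Q) (\<lambda>\<xi>. complex_of_real (q \<xi>))"
    and conv: "convolution_operator \<Omega> Q A" and sa: "l2_selfadjoint \<Omega> A"
    and enum: "enumerates_eigenvalues \<Omega> A S K ev"
    and sign: "\<And>\<mu>. \<mu> \<in> S \<Longrightarrow> 0 < s * \<mu>" "\<bar>s\<bar> = 1" and lam: "0 \<le> lam"
  shows "(\<Sum>\<^sub>\<infinity>k\<in>K. ennreal (max (\<bar>ev k\<bar> - lam) 0)) \<le> ennreal (measure lebesgue \<Omega> / (2 * pi) ^ DIM('a)) *
    (\<integral>\<^sup>+\<xi>. ennreal (max (s * q \<xi> - lam) 0) \<partial>lebesgue)"
proof (rule infsum_le_finite_sums)
  show "(\<lambda>k. ennreal (max (\<bar>ev k\<bar> - lam) 0)) summable_on K"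
    by (rule nonneg_summable_on_complete) simp
next
  fix F assume F: "finite F" "F \<subseteq> K"
  have A: "A u \<in> L2 \<Omega>" if "u \<in> L2 \<Omega>" for u
    using conv that by (simp add: convolution_operator_def)
  obtain u where u: "\<And>k. k \<in> K \<Longrightarrow> u k \<in> eigenspace \<Omega> A (ev k)"
    and on: "\<And>j k. j \<in> K \<Longrightarrow> k \<in> K \<Longrightarrow> l2_inner \<Omega> (u j) (u k) = (if j = k then 1 else 0)"
    using orthonormal_eigenfunctions[OF A sa enum] by blast
  have uL: "u k \<in> L2 \<Omega>" if "k \<in> K" for k using u[OF that] by (simp add: eigenspace_def)
  let ?p = "\<lambda>k \<xi>. (norm (fourier (zero_ext \<Omega> (u k)) \<xi>))\<^sup>2"
  let ?w = "\<lambda>\<xi>. ennreal (max (s * q \<xi> - lam) 0)"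
  let ?c = "ennreal (1 / (2 * pi) ^ DIM('a))"
  have [measurable]: "zero_ext \<Omega> (u k) \<in> borel_measurable lebesgue" if "k \<in> F" for k
    using integrable_zero_ext[OF \<Omega> uL] that F by (auto dest: borel_measurable_integrable)
  have excess: "ennreal (max (\<bar>ev k\<bar> - lam) 0) \<le> ?c * (\<integral>\<^sup>+\<xi>. ?w \<xi> * ennreal (?p k \<xi>) \<partial>lebesgue)"
    if "k \<in> F" for k
  proof -
    have k: "k \<in> K" using that F by blast
    have pos: "0 < s * ev k" using sign(1) enum k by (auto simp: enumerates_eigenvalues_def)
    have abs: "\<bar>ev k\<bar> = s * ev k" using pos sign(2) by (metis abs_mult abs_of_pos mult_1)
    have form: "l2_inner \<Omega> (A (u k)) (u k) = (\<integral>\<xi>. complex_of_real (q \<xi>) * fourier (zero_ext \<Omega> (u k)) \<xi>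
        * cnj (fourier (zero_ext \<Omega> (u k)) \<xi>) \<partial>lebesgue) / (2 * pi) ^ DIM('a)"
      using conv rep uL[OF k] by (simp add: convolution_operator_def)
    have "ennreal (s * ev k - lam) \<le> ?c * (\<integral>\<^sup>+\<xi>. ?w \<xi> * ennreal (?p k \<xi>) \<partial>lebesgue)"
      by (rule eigenvalue_excess_le[OF \<Omega> form A[OF uL[OF k]] u[OF k] _ pos lam]) (simp add: on k)
    then show ?thesis by (simp add: abs max_def ennreal_neg)
  qed
  have "(\<Sum>k\<in>F. ennreal (max (\<bar>ev k\<bar> - lam) 0)) \<le> (\<Sum>k\<in>F. ?c * (\<integral>\<^sup>+\<xi>. ?w \<xi> * ennreal (?p k \<xi>) \<partial>lebesgue))"
    by (rule sum_mono) (rule excess)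
  also have "\<dots> = ?c * (\<integral>\<^sup>+\<xi>. (\<Sum>k\<in>F. ?w \<xi> * ennreal (?p k \<xi>)) \<partial>lebesgue)"
    by (subst nn_integral_sum) (auto simp: sum_distrib_left)
  also have "\<dots> \<le> ?c * (\<integral>\<^sup>+\<xi>. ?w \<xi> * ennreal (measure lebesgue \<Omega>) \<partial>lebesgue)"
  proof (intro mult_left_mono nn_integral_mono)
    fix \<xi> :: 'a
    have "(\<Sum>k\<in>F. ?p k \<xi>) \<le> measure lebesgue \<Omega>"
      by (rule sum_fourier_orthonormal_le[OF \<Omega> F(1) uL on]) (use F(2) in auto)
    then show "(\<Sum>k\<in>F. ?w \<xi> * ennreal (?p k \<xi>)) \<le> ?w \<xi> * ennreal (measure lebesgue \<Omega>)"
      unfolding sum_distrib_left[symmetric]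
      by (intro mult_left_mono) (simp_all add: sum_ennreal ennreal_leI)
  qed simp
  also have "\<dots> = ennreal (measure lebesgue \<Omega> / (2 * pi) ^ DIM('a)) * (\<integral>\<^sup>+\<xi>. ?w \<xi> \<partial>lebesgue)"
  proof -
    have "ennreal (measure lebesgue \<Omega> / (2 * pi) ^ DIM('a)) = ?c * ennreal (measure lebesgue \<Omega>)"
      by (simp flip: ennreal_mult)
    moreover have "(\<integral>\<^sup>+\<xi>. ?w \<xi> * ennreal (measure lebesgue \<Omega>) \<partial>lebesgue)
        = (\<integral>\<^sup>+\<xi>. ?w \<xi> \<partial>lebesgue) * ennreal (measure lebesgue \<Omega>)"
      by (rule nn_integral_multc) measurable
    ultimately show ?thesis by (simp only: mult_ac)
  qed
  finally show "(\<Sum>k\<in>F. ennreal (max (\<bar>ev k\<bar> - lam) 0))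
      \<le> ennreal (measure lebesgue \<Omega> / (2 * pi) ^ DIM('a)) * (\<integral>\<^sup>+\<xi>. ?w \<xi> \<partial>lebesgue)" .
qed

theorem theorem1:
  fixes \<Omega> :: "(real ^ 'n) set"
    and Q :: "(real ^ 'n \<Rightarrow> complex) \<Rightarrow> complex"
    and q :: "real ^ 'n \<Rightarrow> real"
    and A :: "(real ^ 'n \<Rightarrow> complex) \<Rightarrow> real ^ 'n \<Rightarrow> complex"
    and Kp Kn :: "nat set"
    and evp evn :: "nat \<Rightarrow> real"
    and lam :: real
  assumes "open \<Omega>" and "connected \<Omega>" and "\<Omega> \<noteq> {}"
    and "emeasure lebesgue \<Omega> < \<infinity>"
    and "tempered_distribution Q"
    and "locally_integrable q"
    and "represented_by (fourier_distr Q) (\<lambda>\<xi>. complex_of_real (q \<xi>))"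
    and "(q \<longlongrightarrow> 0) at_infinity"
    and "convolution_operator \<Omega> Q A"
    and "l2_compact \<Omega> A"
    and "l2_selfadjoint \<Omega> A"
    and "enumerates_eigenvalues \<Omega> A {0<..} Kp evp"
    and "enumerates_eigenvalues \<Omega> A {..<0} Kn evn"
    and "lam > 0"
  shows "(\<Sum>\<^sub>\<infinity>k\<in>Kp. ennreal (max (\<bar>evp k\<bar> - lam) 0)) + (\<Sum>\<^sub>\<infinity>k\<in>Kn. ennreal (max (\<bar>evn k\<bar> - lam) 0))
     \<le> ennreal (measure lebesgue \<Omega> / (2 * pi) ^ CARD('n)) *
        (\<integral>\<^sup>+\<xi>. ennreal (max (\<bar>q \<xi>\<bar> - lam) 0) \<partial>lebesgue)"
proof -
  have \<Omega>: "\<Omega> \<in> sets lebesgue"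
    using \<open>open \<Omega>\<close> by (intro sets_completionI_sets) simp
  have q[measurable]: "q \<in> borel_measurable lebesgue"
    by (rule measurable_if_locally_integrable) fact
  note sum_le = signed_eigenvalue_sum_le[OF \<Omega> \<open>emeasure lebesgue \<Omega> < \<infinity>\<close> q
    \<open>represented_by (fourier_distr Q) (\<lambda>\<xi>. complex_of_real (q \<xi>))\<close>
    \<open>convolution_operator \<Omega> Q A\<close> \<open>l2_selfadjoint \<Omega> A\<close>]
  let ?c = "ennreal (measure lebesgue \<Omega> / (2 * pi) ^ CARD('n))"
  have p: "(\<Sum>\<^sub>\<infinity>k\<in>Kp. ennreal (max (\<bar>evp k\<bar> - lam) 0))
      \<le> ?c * (\<integral>\<^sup>+\<xi>. ennreal (max (1 * q \<xi> - lam) 0) \<partial>lebesgue)"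
    using sum_le[OF \<open>enumerates_eigenvalues \<Omega> A {0<..} Kp evp\<close>, of 1 lam] \<open>lam > 0\<close> by simp
  have n: "(\<Sum>\<^sub>\<infinity>k\<in>Kn. ennreal (max (\<bar>evn k\<bar> - lam) 0))
      \<le> ?c * (\<integral>\<^sup>+\<xi>. ennreal (max (- 1 * q \<xi> - lam) 0) \<partial>lebesgue)"
    using sum_le[OF \<open>enumerates_eigenvalues \<Omega> A {..<0} Kn evn\<close>, of "-1" lam] \<open>lam > 0\<close> by simp
  have "max (1 * q \<xi> - lam) 0 + max (- 1 * q \<xi> - lam) 0 = max (\<bar>q \<xi>\<bar> - lam) 0" for \<xi>
    using \<open>lam > 0\<close> by linarith
  then have "ennreal (max (1 * q \<xi> - lam) 0) + ennreal (max (- 1 * q \<xi> - lam) 0)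
      = ennreal (max (\<bar>q \<xi>\<bar> - lam) 0)" for \<xi>
    by (subst ennreal_plus[symmetric]) simp_all
  then have "(\<integral>\<^sup>+\<xi>. ennreal (max (1 * q \<xi> - lam) 0) \<partial>lebesgue)
      + (\<integral>\<^sup>+\<xi>. ennreal (max (- 1 * q \<xi> - lam) 0) \<partial>lebesgue)
      = (\<integral>\<^sup>+\<xi>. ennreal (max (\<bar>q \<xi>\<bar> - lam) 0) \<partial>lebesgue)"
    by (subst nn_integral_add[symmetric]) (simp_all only:, measurable)
  with add_mono[OF p n] show ?thesis
    by (simp only: distrib_left[symmetric])
qed

end
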